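(* Let $\mathcal M$ be an internal unital $C^*$-algebra with nonstandard hull $\widehat{\mathcal M}$, and let $p\in\mathcal M$ be a projection. Then $p$ is an infinite projection of $\mathcal M$ if and only if $\widehat p$ is an infinite projection of $\widehat{\mathcal M}$.
   Context: Work in a nonstandard universe (in the sense of Robinson's nonstandard analysis) that is $\kappa$-saturated for a sufficiently large uncountable cardinal $\kappa$. All $C^*$-algebras are unital. An internal $C^*$-algebra $\mathcal M$ is an internal object satisfying (by transfer) the definition of a $C^*$-algebra over ${}^*\mathbb C$, with norm valued in ${}^*\mathbb R$. For $r,s\in{}^*\mathbb R$, $r\approx s$ means $|r-s|<1/n$ for all standard $n\ge 1$; $r$ is finite ($|r|<\infty$) if $|r|<n$ for some standard $n$, and then ${}^\circ r\in\mathbb R$ is its standard part. Put $\mathrm{Fin}(\mathcal M)=\{a\in\mathcal M:\|a\|<\infty\}$; $a\approx b$ means $\|a-b\|\approx 0$; $\widehat a=\{x\in\mathcal M: x\approx a\}$. The nonstandard hull is $\widehat{\mathcal M}=\{\widehat a: a\in\mathrm{Fin}(\mathcal M)\}$ with $\widehat a+\widehat b=\widehat{a+b}$, $\widehat a\,\widehat b=\widehat{ab}$, $(\widehat a)^*=\widehat{a^*}$, unit $\widehat 1$, scalar multiplication induced likewise, and $\|\widehat a\|={}^\circ\|a\|$; it is an ordinary $C^*$-algebra. Projections $p,q$ of a $C^*$-algebra are Murray–von Neumann equivalent, $p\sim q$, if $u^*u=p$ and $uu^*=q$ for some partial isometry $u$ in the algebra. A projection $p$ is infinite if there is a projection $q$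 in the algebra with $p\sim q$, $q\le p$ and $q\ne p$. For the internal algebra $\mathcal M$ these notions are the internal (transferred) ones. *)

theory Defs
  imports Complex_Main "HOL-Algebra.Algebraic_Closure_Type"
begin

section \<open>Unital C*-algebras on carrier sets\<close>

text \<open>The types of scalars and of norm values are parameters of the record: they are
  \<^typ>\<open>complex\<close> and \<^typ>\<open>real\<close> for an ordinary algebra, whereas an internal algebra has
  hypercomplex scalars and hyperreal norms.\<close>

record ('s, 'a, 'n) star_alg = "('s, 'a) module" +
  adj :: "'a \<Rightarrow> 'a"
  nrm :: "'a \<Rightarrow> 'n"

text \<open>The zero algebra is not excluded.\<close>

locale cstar_algebra =
  module "ring_of_type_algebra :: complex ring" A + ring A
  for A :: "(complex, 'a, real) star_alg" (structure) +
  assumes smult_mult_left: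
      "\<lbrakk>x \<in> carrier A; y \<in> carrier A\<rbrakk> \<Longrightarrow> (c \<odot> x) \<otimes> y = c \<odot> (x \<otimes> y)"
    and smult_mult_right:
      "\<lbrakk>x \<in> carrier A; y \<in> carrier A\<rbrakk> \<Longrightarrow> x \<otimes> (c \<odot> y) = c \<odot> (x \<otimes> y)"
    and adj_closed: "x \<in> carrier A \<Longrightarrow> adj A x \<in> carrier A"
    and adj_adj: "x \<in> carrier A \<Longrightarrow> adj A (adj A x) = x"
    and adj_add:
      "\<lbrakk>x \<in> carrier A; y \<in> carrier A\<rbrakk> \<Longrightarrow> adj A (x \<oplus> y) = adj A x \<oplus> adj A y"
    and adj_smult: "x \<in> carrier A \<Longrightarrow> adj A (c \<odot> x) = cnj c \<odot> adj A x"
    and adj_mult: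
      "\<lbrakk>x \<in> carrier A; y \<in> carrier A\<rbrakk> \<Longrightarrow> adj A (x \<otimes> y) = adj A y \<otimes> adj A x"
    and nrm_nonneg: "x \<in> carrier A \<Longrightarrow> 0 \<le> nrm A x"
    and nrm_eq_0: "x \<in> carrier A \<Longrightarrow> nrm A x = 0 \<longleftrightarrow> x = \<zero>"
    and nrm_triangle:
      "\<lbrakk>x \<in> carrier A; y \<in> carrier A\<rbrakk> \<Longrightarrow> nrm A (x \<oplus> y) \<le> nrm A x + nrm A y"
    and nrm_smult: "x \<in> carrier A \<Longrightarrow> nrm A (c \<odot> x) = cmod c * nrm A x"
    and nrm_mult:
      "\<lbrakk>x \<in> carrier A; y \<in> carrier A\<rbrakk> \<Longrightarrow> nrm A (x \<otimes> y) \<le> nrm A x * nrm A y"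
    and cstar_identity: "x \<in> carrier A \<Longrightarrow> nrm A (adj A x \<otimes> x) = (nrm A x)\<^sup>2"
    and complete:
      "\<lbrakk>\<And>n. s n \<in> carrier A;
        \<And>e. e > 0 \<Longrightarrow> \<exists>N. \<forall>m\<ge>N. \<forall>n\<ge>N. nrm A (s m \<ominus> s n) < e\<rbrakk>
       \<Longrightarrow> \<exists>l\<in>carrier A. (\<lambda>n. nrm A (s n \<ominus> l)) \<longlonglongrightarrow> 0"


section \<open>Projections\<close>

definition is_projection :: "('s, 'a, 'n) star_alg \<Rightarrow> 'a \<Rightarrow> bool" where
  "is_projection A p \<longleftrightarrow> p \<in> carrier A \<and> p \<otimes>\<^bsub>A\<^esub> p = p \<and> adj A p = p"

definition partial_isometry :: "('s, 'a, 'n) star_alg \<Rightarrow> 'a \<Rightarrow> bool" where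
  "partial_isometry A u \<longleftrightarrow> u \<in> carrier A \<and> is_projection A (adj A u \<otimes>\<^bsub>A\<^esub> u)"

definition mvn_equiv :: "('s, 'a, 'n) star_alg \<Rightarrow> 'a \<Rightarrow> 'a \<Rightarrow> bool" where
  "mvn_equiv A p q \<longleftrightarrow>
     (\<exists>u. partial_isometry A u \<and> adj A u \<otimes>\<^bsub>A\<^esub> u = p \<and> u \<otimes>\<^bsub>A\<^esub> adj A u = q)"

text \<open>The usual order of projections.\<close>

definition proj_le :: "('s, 'a, 'n) star_alg \<Rightarrow> 'a \<Rightarrow> 'a \<Rightarrow> bool" where
  "proj_le A q p \<longleftrightarrow> p \<otimes>\<^bsub>A\<^esub> q = q \<and> q \<otimes>\<^bsub>A\<^esub> p = q"

definition infinite_projection :: "('s, 'a, 'n) star_alg \<Rightarrow> 'a \<Rightarrow> bool" where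
  "infinite_projection A p \<longleftrightarrow>
     is_projection A p \<and>
     (\<exists>q. is_projection A q \<and> mvn_equiv A p q \<and> proj_le A q p \<and> q \<noteq> p)"


section \<open>Nonstandard universes\<close>

text \<open>The standard universe consists of the reals, the complex numbers, a type \<open>'x\<close> of points,
  and all algebra structures on sets of points. The type \<open>'x\<close> is arbitrary, so it may itself be
  a level of a superstructure.\<close>

datatype 'x obj =
    OReal real
  | OComplex complex
  | OPoint 'x
  | OAlg "(complex, 'x, real) star_alg"

text \<open>First-order formulas over the full language of a structure with domain \<open>'v\<close>: every set
  of lists over \<open>'v\<close> is a relation symbol. Variables are natural numbers.\<close>

datatype 'v form =
    Rel "'v list set" "nat list"
  | Eq nat nat
  | Neg "'v form"
  | Conj "'v form" "'v form"
  | Ex nat "'v form"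

primrec holds :: "('v list set \<Rightarrow> 'u list set) \<Rightarrow> (nat \<Rightarrow> 'u) \<Rightarrow> 'v form \<Rightarrow> bool" where
  "holds I e (Rel R vs) \<longleftrightarrow> map e vs \<in> I R"
| "holds I e (Eq i j) \<longleftrightarrow> e i = e j"
| "holds I e (Neg f) \<longleftrightarrow> \<not> holds I e f"
| "holds I e (Conj f g) \<longleftrightarrow> holds I e f \<and> holds I e g"
| "holds I e (Ex i f) \<longleftrightarrow> (\<exists>x. holds I (e(i := x)) f)"

text \<open>The type \<open>'w\<close> is the type of internal objects; \<open>star U a\<close> is the nonstandard extension of
  the standard object \<open>a\<close>, and \<open>ext U R\<close> that of the standard relation \<open>R\<close>.\<close>

record ('v, 'w) universe =
  star :: "'v \<Rightarrow> 'w"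
  ext :: "'v list set \<Rightarrow> 'w list set"

definition transfer_principle :: "('v, 'w) universe \<Rightarrow> bool" where
  "transfer_principle U \<longleftrightarrow>
     (\<forall>f e. holds (\<lambda>R. R) e f \<longleftrightarrow> holds (ext U) (star U \<circ> e) f)"

definition internal_set :: "('v, 'w) universe \<Rightarrow> 'w set \<Rightarrow> bool" where
  "internal_set U S \<longleftrightarrow> (\<exists>R ps. S = {w. w # ps \<in> ext U R})"

unbundle cardinal_syntax

definition saturated :: "'k rel \<Rightarrow> ('v, 'w) universe \<Rightarrow> bool" where
  "saturated \<kappa> U \<longleftrightarrow>
     (\<forall>F. (\<forall>S\<in>F. internal_set U S) \<and> |F| <o \<kappa> \<and>
          (\<forall>G\<subseteq>F. finite G \<longrightarrow> \<Inter>G \<noteq> {}) \<longrightarrow> \<Inter>F \<noteq> {})"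

definition nonstandard_universe :: "'k rel \<Rightarrow> ('v, 'w) universe \<Rightarrow> bool" where
  "nonstandard_universe \<kappa> U \<longleftrightarrow>
     Card_order \<kappa> \<and> natLeq <o \<kappa> \<and> transfer_principle U \<and> saturated \<kappa> U"


section \<open>Hyperreals\<close>

text \<open>For a standard \<open>n\<close>, the extension of the relation \<open>\<bar>x - y\<bar> < 1/n\<close> is the same relation
  between hyperreals; likewise for \<open>\<bar>x\<bar> < n\<close>.\<close>

definition hr_approx :: "('x obj, 'w) universe \<Rightarrow> 'w \<Rightarrow> 'w \<Rightarrow> bool" where
  "hr_approx U r s \<longleftrightarrow>
     (\<forall>n::nat. n \<ge> 1 \<longrightarrow> [r, s] \<in> ext U {[OReal x, OReal y] | x y. \<bar>x - y\<bar> < 1 / real n})"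

definition hr_finite :: "('x obj, 'w) universe \<Rightarrow> 'w \<Rightarrow> bool" where
  "hr_finite U r \<longleftrightarrow> (\<exists>n::nat. [r] \<in> ext U {[OReal x] | x. \<bar>x\<bar> < real n})"

definition std_part :: "('x obj, 'w) universe \<Rightarrow> 'w \<Rightarrow> real" where
  "std_part U r = (THE x. hr_approx U r (star U (OReal x)))"


section \<open>Internal C*-algebras\<close>

definition internal_cstar_algebra :: "('x obj, 'w) universe \<Rightarrow> 'w \<Rightarrow> bool" where
  "internal_cstar_algebra U M \<longleftrightarrow> [M] \<in> ext U {[OAlg A] | A. cstar_algebra A}"

text \<open>The carrier and the operations of an internal algebra, obtained by extending the
  membership relation and the graphs of the operations of all standard algebras.\<close>

definition internal_alg :: "('x obj, 'w) universe \<Rightarrow> 'w \<Rightarrow> ('w, 'w, 'w) star_alg" where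
  "internal_alg U M = \<lparr>
     carrier = {x. [M, x] \<in> ext U {[OAlg A, OPoint a] | A a. cstar_algebra A \<and> a \<in> carrier A}},
     monoid.mult = (\<lambda>x y. THE z. [M, x, y, z] \<in>
       ext U {[OAlg A, OPoint a, OPoint b, OPoint (a \<otimes>\<^bsub>A\<^esub> b)] | A a b.
                cstar_algebra A \<and> a \<in> carrier A \<and> b \<in> carrier A}),
     one = (THE z. [M, z] \<in> ext U {[OAlg A, OPoint \<one>\<^bsub>A\<^esub>] | A. cstar_algebra A}),
     ring.zero = (THE z. [M, z] \<in> ext U {[OAlg A, OPoint \<zero>\<^bsub>A\<^esub>] | A. cstar_algebra A}),
     add = (\<lambda>x y. THE z. [M, x, y, z] \<in>
       ext U {[OAlg A, OPoint a, OPoint b, OPoint (a \<oplus>\<^bsub>A\<^esub> b)] | A a b.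
                cstar_algebra A \<and> a \<in> carrier A \<and> b \<in> carrier A}),
     module.smult = (\<lambda>c x. THE z. [M, c, x, z] \<in>
       ext U {[OAlg A, OComplex d, OPoint a, OPoint (d \<odot>\<^bsub>A\<^esub> a)] | A d a.
                cstar_algebra A \<and> a \<in> carrier A}),
     adj = (\<lambda>x. THE z. [M, x, z] \<in>
       ext U {[OAlg A, OPoint a, OPoint (adj A a)] | A a. cstar_algebra A \<and> a \<in> carrier A}),
     nrm = (\<lambda>x. THE r. [M, x, r] \<in>
       ext U {[OAlg A, OPoint a, OReal (nrm A a)] | A a. cstar_algebra A \<and> a \<in> carrier A})\<rparr>"

text \<open>The internal version, by transfer, of a property \<open>P\<close> of elements of C*-algebras.\<close>

definition internally ::
  "('x obj, 'w) universe \<Rightarrow> ((complex, 'x, real) star_alg \<Rightarrow> 'x \<Rightarrow> bool) \<Rightarrow> 'w \<Rightarrow> 'w \<Rightarrow> bool" where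
  "internally U P M x \<longleftrightarrow>
     [M, x] \<in> ext U {[OAlg A, OPoint a] | A a. cstar_algebra A \<and> a \<in> carrier A \<and> P A a}"


section \<open>Nonstandard hulls\<close>

definition Fin :: "('x obj, 'w) universe \<Rightarrow> 'w \<Rightarrow> 'w set" where
  "Fin U M = {a \<in> carrier (internal_alg U M). hr_finite U (nrm (internal_alg U M) a)}"

definition approx :: "('x obj, 'w) universe \<Rightarrow> 'w \<Rightarrow> 'w \<Rightarrow> 'w \<Rightarrow> bool" where
  "approx U M a b \<longleftrightarrow>
     hr_approx U (nrm (internal_alg U M) (a \<ominus>\<^bsub>internal_alg U M\<^esub> b)) (star U (OReal 0))"

definition hat :: "('x obj, 'w) universe \<Rightarrow> 'w \<Rightarrow> 'w \<Rightarrow> 'w set" where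
  "hat U M a = {x \<in> carrier (internal_alg U M). approx U M x a}"

text \<open>Each union below is taken over representatives of the given classes; all its members
  coincide. A standard scalar \<open>c\<close> acts through its extension.\<close>

definition nonstandard_hull :: "('x obj, 'w) universe \<Rightarrow> 'w \<Rightarrow> (complex, 'w set, real) star_alg" where
  "nonstandard_hull U M = (let I = internal_alg U M in \<lparr>
     carrier = hat U M ` Fin U M,
     monoid.mult = (\<lambda>S T. \<Union>a\<in>S. \<Union>b\<in>T. hat U M (a \<otimes>\<^bsub>I\<^esub> b)),
     one = hat U M \<one>\<^bsub>I\<^esub>,
     ring.zero = hat U M \<zero>\<^bsub>I\<^esub>,
     add = (\<lambda>S T. \<Union>a\<in>S. \<Union>b\<in>T. hat U M (a \<oplus>\<^bsub>I\<^esub> b)),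
     module.smult = (\<lambda>c S. \<Union>a\<in>S. hat U M (star U (OComplex c) \<odot>\<^bsub>I\<^esub> a)),
     adj = (\<lambda>S. \<Union>a\<in>S. hat U M (adj I a)),
     nrm = (\<lambda>S. THE r. \<exists>a\<in>S. r = std_part U (nrm I a))\<rparr>)"

end

theory Submission
  imports Defs
begin

text \<open>The algebra operations and the relations \<open>\<approx>\<close> and \<open>< \<infinity>\<close> are transferred by describing
  internal objects as values of standard functions: for a tuple \<open>ws\<close> of internal objects, the
  standard properties that hold internally of \<open>ws\<close> form an ultrafilter, and an internal object
  definable from \<open>ws\<close> behaves as the class of a function modulo that ultrafilter.

  If \<open>p\<close> is internally infinite, witnessed by \<open>u\<close>, then \<open>u\<close> has norm at most 1 and
  \<open>p - uu*\<close>, being a nonzero projection, has norm 1, so the class of \<open>u\<close> is a witness in the hull.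
  Conversely, a witness in the hull is represented by some \<open>v\<close> with \<open>v*v \<approx> p\<close> and \<open>pvv* \<approx> vv*\<close>
  but \<open>\<parallel>vv* - p\<parallel> \<ge> \<eta>\<close> for a standard \<open>\<eta> > 0\<close>. In a C*-algebra, such approximate relations suffice
  for \<open>p\<close> to be infinite: starting from \<open>pvp\<close>, the Newton iteration
  \<open>u \<mapsto> u + u(p - u*u)/2\<close> converges to a nearby \<open>u\<close> with \<open>u*u = p\<close> exactly.\<close>

subsection \<open>Values of standard functions\<close>

text \<open>The transfer principle evaluates formulas at standard objects only. Quantifying away the
  variables below \<open>n\<close> lets them range over all internal objects after transfer.\<close>

primrec exs :: "nat \<Rightarrow> 'v form \<Rightarrow> 'v form" where
  "exs 0 f = f"
| "exs (Suc n) f = exs n (Ex n f)"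

lemma holds_exs:
  "holds I e (exs n f) \<longleftrightarrow> (\<exists>e'. (\<forall>i\<ge>n. e' i = e i) \<and> holds I e' f)"
proof (induction n arbitrary: f)
  case 0
  have "e' = e" if "\<forall>i\<ge>0. e' i = e i" for e'
    using that by auto
  then show ?case by auto
next
  case (Suc n)
  have "(\<exists>e'. (\<forall>i\<ge>n. e' i = e i) \<and> (\<exists>x. holds I (e'(n := x)) f)) \<longleftrightarrow>
        (\<exists>e'. (\<forall>i\<ge>Suc n. e' i = e i) \<and> holds I e' f)" (is "?l = ?r")
  proof
    assume ?l
    then obtain e' x where "\<forall>i\<ge>n. e' i = e i" "holds I (e'(n := x)) f" by blast
    then show ?r by (intro exI[of _ "e'(n := x)"]) auto
  next
    assume ?r
    then obtain e' where e': "\<forall>i\<ge>Suc n. e' i = e i" "holds I e' f" by blast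
    then have "\<forall>i\<ge>n. (e'(n := e n)) i = e i"
      by (metis Suc_leI fun_upd_apply le_neq_implies_less)
    with e' show ?l
      by (intro exI[of _ "e'(n := e n)"]) (auto intro!: exI[of _ "e' n"])
  qed
  with Suc show ?case by simp
qed

text \<open>Beyond the tuple the assignment takes the value \<open>star U undefined\<close>, so that
  there it agrees with the standard assignment at which the closed formula is transferred.\<close>

definition env :: "('v, 'w) universe \<Rightarrow> 'w list \<Rightarrow> nat \<Rightarrow> 'w" where
  "env U ws i = (if i < length ws then ws ! i else star U undefined)"

lemma map_env: "(\<And>i. i \<in> set vs \<Longrightarrow> i < length ws) \<Longrightarrow> map (env U ws) vs = map ((!) ws) vs"
  by (auto simp: env_def)

lemma map_env_upt [simp]: "map (env U ws) [0..<length ws] = ws"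
  by (rule nth_equalityI) (auto simp: env_def)

text \<open>If no standard assignment falsifies \<open>f\<close>, then \<open>exs\<close> applied to
  the negation of \<open>f\<close> fails at a standard assignment. By transfer it fails internally,
  so no internal tuple falsifies \<open>f\<close>.\<close>

lemma transfer_valid:
  assumes "transfer_principle U" and "\<And>e. holds (\<lambda>R. R) e f"
  shows "holds (ext U) (env U ws) f"
proof -
  have "\<not> holds (\<lambda>R. R) (\<lambda>_. undefined) (exs (length ws) (Neg f))"
    using assms(2) by (simp add: holds_exs)
  then have "\<not> holds (ext U) (star U \<circ> (\<lambda>_. undefined)) (exs (length ws) (Neg f))"
    using assms(1) by (simp add: transfer_principle_def)
  then show ?thesis
    unfolding holds_exs by (auto simp: env_def dest: spec[of _ "env U ws"])
qed

text \<open>The standard properties that hold internally of the tuple \<open>ws\<close>; by transfer, an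
  ultrafilter.\<close>

definition frame :: "('v, 'w) universe \<Rightarrow> 'w list \<Rightarrow> 'v list filter" where
  "frame U ws = Abs_filter (\<lambda>P. ws \<in> ext U {xs. P xs})"

section \<open>The ultrafilter attached to an internal tuple\<close>

locale transfer_universe =
  fixes U :: "('v, 'w) universe"
  assumes transfer: "transfer_principle U"
begin

text \<open>The transferred formula applies \<open>R\<close> and \<open>S\<close> to exactly
  \<open>length ws\<close> variables, hence only lists of that length have to be compared.\<close>

lemma ext_impl:
  assumes "R \<inter> {xs. length xs = length ws} \<subseteq> S" "ws \<in> ext U R"
  shows "ws \<in> ext U S"
proof -
  let ?f = "Neg (Conj (Rel R [0..<length ws]) (Neg (Rel S [0..<length ws])))"
  have "holds (ext U) (env U ws) ?f"
    using assms(1) by (intro transfer_valid[OF transfer]) auto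
  then show ?thesis using assms(2) by simp
qed

lemma ext_Compl: "ws \<in> ext U (- R) \<longleftrightarrow> ws \<notin> ext U R"
proof -
  let ?a = "Rel R [0..<length ws]" and ?b = "Rel (- R) [0..<length ws]"
  have "holds (ext U) (env U ws) (Conj (Neg (Conj ?a ?b)) (Neg (Conj (Neg ?a) (Neg ?b))))"
    by (intro transfer_valid[OF transfer]) auto
  then show ?thesis by auto
qed

lemma ext_Int: "ws \<in> ext U (R \<inter> S) \<longleftrightarrow> ws \<in> ext U R \<and> ws \<in> ext U S"
proof -
  let ?a = "Rel R [0..<length ws]" and ?b = "Rel S [0..<length ws]"
    and ?c = "Rel (R \<inter> S) [0..<length ws]"
  have "holds (ext U) (env U ws) (Neg (Conj (Conj ?a ?b) (Neg ?c)))"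
    by (intro transfer_valid[OF transfer]) auto
  then show ?thesis by (auto intro: ext_impl[rotated])
qed

text \<open>Extension respects intersections and supersets, so the predicate in the definition of
  \<open>frame\<close> is a filter and \<open>Abs_filter\<close> can be undone.\<close>

lemma eventually_frame: "eventually P (frame U ws) \<longleftrightarrow> ws \<in> ext U {xs. P xs}"
proof -
  have "is_filter (\<lambda>P. ws \<in> ext U {xs. P xs})"
  proof
    show "ws \<in> ext U {xs. True}"
      using ext_Compl[of ws "{}"] ext_impl[of "{}" ws UNIV] by auto
  next
    fix P Q assume "ws \<in> ext U {xs. P xs}" "ws \<in> ext U {xs. Q xs}"
    then show "ws \<in> ext U {xs. P xs \<and> Q xs}"
      by (simp add: Collect_conj_eq ext_Int)
  next
    fix P Q :: "'v list \<Rightarrow> bool"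
    assume "\<forall>x. P x \<longrightarrow> Q x" "ws \<in> ext U {xs. P xs}"
    then show "ws \<in> ext U {xs. Q xs}"
      by (auto elim: ext_impl[rotated])
  qed
  then show ?thesis
    by (simp add: frame_def eventually_Abs_filter)
qed

text \<open>The ultrafilter property: negations, such as the failure of an approximation, also pass
  to almost every standard tuple.\<close>

lemma eventually_not_frame:
  "eventually (\<lambda>xs. \<not> P xs) (frame U ws) \<longleftrightarrow> \<not> eventually P (frame U ws)"
  using ext_Compl[of ws "Collect P"] by (simp add: eventually_frame Collect_neg_eq)

text \<open>This contains properness of the filter: the complement of the true predicate does not
  hold eventually.\<close>

lemma eventually_const_frame [simp]: "eventually (\<lambda>_. P) (frame U ws) \<longleftrightarrow> P"
  using eventually_not_frame[of "\<lambda>_. True" ws] by (cases P) auto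

lemma eventually_length_frame: "eventually (\<lambda>xs. length xs = length ws) (frame U ws)"
proof -
  have "ws \<in> ext U UNIV"
    using eventually_frame[of "\<lambda>_. True" ws] by simp
  then show ?thesis
    unfolding eventually_frame by (rule ext_impl[rotated]) auto
qed

text \<open>Selecting entries by \<open>vs\<close> is a substitution of variables, so a relation on
  a subtuple is a relation on the whole of \<open>ws\<close>. This moves statements between the
  frames of different tuples.\<close>

lemma eventually_frame_nths:
  assumes "\<And>i. i \<in> set vs \<Longrightarrow> i < length ws"
  shows "map ((!) ws) vs \<in> ext U R \<longleftrightarrow> eventually (\<lambda>xs. map ((!) xs) vs \<in> R) (frame U ws)"
proof -
  let ?n = "length ws"
  let ?a = "Rel R vs" and ?b = "Rel {xs. map ((!) xs) vs \<in> R} [0..<?n]"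
  have *: "map ((!) (map e [0..<?n])) vs = map e vs" for e :: "nat \<Rightarrow> 'v"
    using assms by auto
  have "holds (ext U) (env U ws)
      (Conj (Neg (Conj ?a (Neg ?b))) (Neg (Conj (Neg ?a) ?b)))"
    by (intro transfer_valid[OF transfer]) (simp add: *)
  then show ?thesis
    by (auto simp: eventually_frame map_env[OF assms])
qed

text \<open>The equality symbol of formulas is interpreted by true equality on both sides, so
  coordinates that agree eventually belong to one internal object.\<close>

lemma eventually_frame_eq:
  assumes "i < length ws" "j < length ws"
  shows "eventually (\<lambda>xs. xs ! i = xs ! j) (frame U ws) \<longleftrightarrow> ws ! i = ws ! j"
proof -
  let ?n = "length ws"
  let ?a = "Eq i j" and ?b = "Rel {xs. xs ! i = xs ! j} [0..<?n]"
  have "holds (ext U) (env U ws)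
      (Conj (Neg (Conj ?a (Neg ?b))) (Neg (Conj (Neg ?a) ?b)))"
    using assms by (intro transfer_valid[OF transfer]) simp
  then show ?thesis
    using assms by (auto simp: eventually_frame env_def)
qed

section \<open>Internal values of standard functions and Los's theorem\<close>

text \<open>The internal object \<open>\<^sup>*f ws\<close>.\<close>

definition val :: "'w list \<Rightarrow> ('v list \<Rightarrow> 'v) \<Rightarrow> 'w" where
  "val ws f = (SOME w. eventually (\<lambda>xs. hd xs = f (tl xs)) (frame U (w # ws)))"

text \<open>Totality of the graph of \<open>f\<close> is valid for standard tuples. Transferred with
  \<open>ws\<close> as parameters, it provides the witness that the choice in \<open>val\<close>
  requires.\<close>

lemma eventually_val: "eventually (\<lambda>xs. hd xs = f (tl xs)) (frame U (val ws f # ws))"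
proof -
  let ?n = "length ws"
  have "holds (ext U) (env U ws) (Ex ?n (Rel {xs. hd xs = f (tl xs)} (?n # [0..<?n])))"
    by (intro transfer_valid[OF transfer]) auto
  moreover have "map ((env U ws)(?n := w)) (?n # [0..<?n]) = w # ws" for w
    by (rule nth_equalityI) (auto simp: env_def nth_Cons split: nat.split)
  ultimately have "\<exists>w. eventually (\<lambda>xs. hd xs = f (tl xs)) (frame U (w # ws))"
    by (auto simp: eventually_frame)
  then show ?thesis
    unfolding val_def by (rule someI_ex)
qed

text \<open>A form of Los's theorem. In the frame of the values followed by the parameters, the
  leading entries are eventually the functions applied to the remaining ones, so a relation among
  the values is a property of the parameters alone.\<close>

lemma map_val_in_ext:
  "map (val ws) fs \<in> ext U R \<longleftrightarrow> eventually (\<lambda>xs. map (\<lambda>f. f xs) fs \<in> R) (frame U ws)"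
proof -
  \<comment> \<open>The concatenation \<open>zs\<close> makes values and parameters visible to a
    single ultrafilter.\<close>
  define k n zs where "k = length fs" "n = length ws" "zs = map (val ws) fs @ ws"
  note kn = this
  have ev1: "eventually (\<lambda>xs. xs ! i = (fs ! i) (drop k xs)) (frame U zs)" if "i < k" for i
  proof -
    have "val ws (fs ! i) # ws = map ((!) zs) (i # [k..<k + n])"
      using that by (intro nth_equalityI) (auto simp: kn nth_append nth_Cons split: nat.split)
    with eventually_val[of "fs ! i" ws]
    have "map ((!) zs) (i # [k..<k + n]) \<in> ext U {xs. hd xs = (fs ! i) (tl xs)}"
      by (simp add: eventually_frame)
    then have "eventually (\<lambda>xs. map ((!) xs) (i # [k..<k + n]) \<in> {xs. hd xs = (fs ! i) (tl xs)})
        (frame U zs)"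
      using that by (subst (asm) eventually_frame_nths) (auto simp: kn)
    then show ?thesis
      using eventually_length_frame
    proof eventually_elim
      case (elim xs)
      have "map ((!) xs) [k..<k + n] = drop k xs"
        using elim(2) by (intro nth_equalityI) (auto simp: kn)
      with elim(1) show ?case by simp
    qed
  qed
  have "eventually (\<lambda>xs. \<forall>i\<in>{..<k}. xs ! i = (fs ! i) (drop k xs)) (frame U zs)"
    by (rule eventually_ball_finite) (use ev1 in auto)
  then have ev: "eventually (\<lambda>xs. take k xs = map (\<lambda>f. f (drop k xs)) fs) (frame U zs)"
    using eventually_length_frame
    by eventually_elim (rule nth_equalityI, auto simp: kn)
  have "map (val ws) fs = map ((!) zs) [0..<k]"
    by (rule nth_equalityI) (auto simp: kn nth_append)
  then have "map (val ws) fs \<in> ext U R \<longleftrightarrow>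
      eventually (\<lambda>xs. map ((!) xs) [0..<k] \<in> R) (frame U zs)"
    by (subst eventually_frame_nths[symmetric]) (auto simp: kn)
  also have "\<dots> \<longleftrightarrow> eventually (\<lambda>xs. take k xs \<in> R) (frame U zs)"
  proof (rule eventually_cong[OF eventually_length_frame])
    fix xs :: "'v list" assume "length xs = length zs"
    then have "map ((!) xs) [0..<k] = take k xs"
      by (intro nth_equalityI) (auto simp: kn)
    then show "(map ((!) xs) [0..<k] \<in> R) = (take k xs \<in> R)"
      by simp
  qed
  also have "\<dots> \<longleftrightarrow> eventually (\<lambda>xs. map (\<lambda>f. f (drop k xs)) fs \<in> R) (frame U zs)"
    using ev by (rule eventually_cong) simp
  also have "\<dots> \<longleftrightarrow> eventually (\<lambda>xs. map ((!) xs) [k..<k + n] \<in> {xs. map (\<lambda>f. f xs) fs \<in> R}) (frame U zs)"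
  proof (rule eventually_cong[OF eventually_length_frame])
    fix xs :: "'v list" assume "length xs = length zs"
    then have "map ((!) xs) [k..<k + n] = drop k xs"
      by (intro nth_equalityI) (auto simp: kn)
    then show "(map (\<lambda>f. f (drop k xs)) fs \<in> R) = (map ((!) xs) [k..<k + n] \<in> {xs. map (\<lambda>f. f xs) fs \<in> R})"
      by simp
  qed
  also have "\<dots> \<longleftrightarrow> map ((!) zs) [k..<k + n] \<in> ext U {xs. map (\<lambda>f. f xs) fs \<in> R}"
    by (subst eventually_frame_nths) (auto simp: kn)
  also have "map ((!) zs) [k..<k + n] = ws"
    by (rule nth_equalityI) (auto simp: kn nth_append)
  finally show ?thesis by (simp add: eventually_frame)
qed

lemma val_eq_iff: "val ws f = val ws g \<longleftrightarrow> eventually (\<lambda>xs. f xs = g xs) (frame U ws)"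
proof -
  have "val ws f = val ws g \<longleftrightarrow> map (val ws) [f, g] \<in> ext U {xs. xs ! 0 = xs ! 1}"
    using eventually_frame_eq[of 0 "map (val ws) [f, g]" 1] by (simp add: eventually_frame)
  also have "\<dots> \<longleftrightarrow> eventually (\<lambda>xs. f xs = g xs) (frame U ws)"
    by (subst map_val_in_ext) simp
  finally show ?thesis .
qed

lemma val_nth:
  assumes "i < length ws"
  shows "val ws (\<lambda>xs. xs ! i) = ws ! i"
proof -
  \<comment> \<open>The value is put in front of \<open>ws\<close>, which shifts entry
    \<open>i\<close> to position \<open>Suc i\<close>.\<close>
  have "eventually (\<lambda>xs. xs ! 0 = xs ! Suc i) (frame U (val ws (\<lambda>xs. xs ! i) # ws))"
    using eventually_val[of "\<lambda>xs. xs ! i" ws] eventually_length_frame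
  proof eventually_elim
    case (elim xs)
    with assms show ?case by (cases xs) auto
  qed
  then show ?thesis
    using assms by (subst (asm) eventually_frame_eq) auto
qed

text \<open>Both objects lie in the extension of the singleton of \<open>c\<close>, and by transfer
  any two members of that extension coincide.\<close>

lemma star_eq_val: "star U c = val ws (\<lambda>_. c)"
proof -
  have "[star U c] \<in> ext U {[c]}"
    using transfer[unfolded transfer_principle_def, rule_format, of "\<lambda>_. c" "Rel {[c]} [0]"] by simp
  moreover have "map (val ws) [\<lambda>_. c] \<in> ext U {[c]}"
    by (subst map_val_in_ext) simp
  moreover have "eventually (\<lambda>xs. map ((!) xs) [i] \<in> {[c]}) (frame U [v, w])"
    if "[[v, w] ! i] \<in> ext U {[c]}" "i < 2" for v w i
    using that eventually_frame_nths[of "[i]" "[v, w]"] by simp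
  note ev = this
  have "eventually (\<lambda>xs. xs ! 0 = xs ! 1) (frame U [v, w])"
    if "[v] \<in> ext U {[c]}" "[w] \<in> ext U {[c]}" for v w
  proof -
    have "eventually (\<lambda>xs. map ((!) xs) [0] \<in> {[c]}) (frame U [v, w])"
      "eventually (\<lambda>xs. map ((!) xs) [1] \<in> {[c]}) (frame U [v, w])"
      using ev[of v w 0] ev[of v w 1] that by simp_all
    then show ?thesis
      by eventually_elim simp
  qed
  ultimately have "eventually (\<lambda>xs. xs ! 0 = xs ! 1) (frame U [star U c, val ws (\<lambda>_. c)])"
    by simp
  then show ?thesis
    by (subst (asm) eventually_frame_eq) auto
qed

text \<open>Appending both candidates \<open>z\<close> and \<open>z'\<close> to \<open>ws\<close>
  turns their equality into a statement about one frame, where uniqueness of the standard value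
  decides it.\<close>

lemma ext_functional:
  assumes "\<And>ys z z'. ys @ [z] \<in> R \<Longrightarrow> ys @ [z'] \<in> R \<Longrightarrow> z = z'"
    and "ws @ [z] \<in> ext U R" "ws @ [z'] \<in> ext U R"
  shows "z = z'"
proof -
  let ?n = "length ws" and ?zs = "ws @ [z, z']"
  have eq: "ws @ [z] = map ((!) ?zs) ([0..<?n] @ [?n])"
    "ws @ [z'] = map ((!) ?zs) ([0..<?n] @ [Suc ?n])"
    by (intro nth_equalityI; auto simp: nth_append less_Suc_eq)+
  have "eventually (\<lambda>xs. map ((!) xs) ([0..<?n] @ [i]) \<in> R) (frame U ?zs)"
    if "map ((!) ?zs) ([0..<?n] @ [i]) \<in> ext U R" "i \<le> Suc ?n" for i
    using that by (subst (asm) eventually_frame_nths) auto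
  from this[of ?n] this[of "Suc ?n"]
  have "eventually (\<lambda>xs. map ((!) xs) ([0..<?n] @ [?n]) \<in> R) (frame U ?zs)"
    "eventually (\<lambda>xs. map ((!) xs) ([0..<?n] @ [Suc ?n]) \<in> R) (frame U ?zs)"
    using assms(2,3) unfolding eq by simp_all
  then have "eventually (\<lambda>xs. xs ! ?n = xs ! Suc ?n) (frame U ?zs)"
    by eventually_elim (auto dest: assms(1))
  then show ?thesis
    by (subst (asm) eventually_frame_eq) (auto simp: nth_append)
qed

text \<open>The operations of \<open>internal_alg\<close> are definite descriptions over extended
  graphs. This rule evaluates them: functionality gives uniqueness, and the pointwise function
  \<open>h\<close> gives existence.\<close>

lemma the_ext_eq_val:
  assumes "\<And>ys z z'. ys @ [z] \<in> R \<Longrightarrow> ys @ [z'] \<in> R \<Longrightarrow> z = z'"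
    and "eventually (\<lambda>xs. map (\<lambda>f. f xs) fs @ [h xs] \<in> R) (frame U ws)"
  shows "(THE z. map (val ws) fs @ [z] \<in> ext U R) = val ws h"
proof (rule the_equality)
  show *: "map (val ws) fs @ [val ws h] \<in> ext U R"
    using map_val_in_ext[of ws "fs @ [h]" R] assms(2) by simp
  show "z = val ws h" if "map (val ws) fs @ [z] \<in> ext U R" for z
    using ext_functional[OF assms(1) that *] .
qed

end

subsection \<open>Perturbation of infinite projections\<close>

context cstar_algebra
begin

section \<open>Basic identities and norm estimates in a C*-algebra\<close>

lemma carrier_scalars [simp]: "c \<in> carrier (ring_of_type_algebra :: complex ring)"
  by (simp add: ring_of_type_algebra_def)

lemma smult_add_left: "x \<in> carrier A \<Longrightarrow> (c + d) \<odot> x = c \<odot> x \<oplus> d \<odot> x"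
  using smult_l_distr[of c d x] by (simp add: ring_of_type_algebra_def)

lemma smult_unit: "x \<in> carrier A \<Longrightarrow> 1 \<odot> x = x"
  using smult_one[of x] by (simp add: ring_of_type_algebra_def)

lemma smult_zero_left: "x \<in> carrier A \<Longrightarrow> 0 \<odot> x = \<zero>"
  using smult_l_null[of x] by (simp add: ring_of_type_algebra_def)

lemma smult_minus_one: assumes "x \<in> carrier A" shows "(-1) \<odot> x = \<ominus> x"
proof (rule sym, rule minus_equality)
  show "(-1) \<odot> x \<oplus> x = \<zero>"
    using smult_add_left[of x "-1" 1] assms by (simp add: smult_unit smult_zero_left)
qed (use assms in auto)

declare adj_closed [simp]

lemma nrm_zero [simp]: "nrm A \<zero> = 0"
  by (simp add: nrm_eq_0)

lemma nrm_uminus: "x \<in> carrier A \<Longrightarrow> nrm A (\<ominus> x) = nrm A x"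
  by (simp add: nrm_smult flip: smult_minus_one)

lemma adj_uminus: "x \<in> carrier A \<Longrightarrow> adj A (\<ominus> x) = \<ominus> adj A x"
  using adj_smult[of x "-1"] by (simp add: smult_minus_one)

lemma adj_minus:
  "\<lbrakk>x \<in> carrier A; y \<in> carrier A\<rbrakk> \<Longrightarrow> adj A (x \<ominus> y) = adj A x \<ominus> adj A y"
  by (simp add: minus_eq adj_add adj_uminus)

lemma nrm_minus_le:
  "\<lbrakk>x \<in> carrier A; y \<in> carrier A\<rbrakk> \<Longrightarrow> nrm A (x \<ominus> y) \<le> nrm A x + nrm A y"
  using nrm_triangle[of x "\<ominus> y"] by (simp add: minus_eq nrm_uminus)

lemma nrm_minus_commute:
  assumes "x \<in> carrier A" "y \<in> carrier A"
  shows "nrm A (x \<ominus> y) = nrm A (y \<ominus> x)"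
proof -
  have "\<ominus> (y \<ominus> x) = x \<ominus> y"
    using assms by (simp add: minus_eq minus_add a_comm)
  then show ?thesis
    using nrm_uminus[of "y \<ominus> x"] assms by simp
qed

lemma minus_add_minus:
  assumes "x \<in> carrier A" "y \<in> carrier A" "z \<in> carrier A"
  shows "x \<ominus> z = (x \<ominus> y) \<oplus> (y \<ominus> z)"
  using assms by (simp add: ring_simprules)

lemma nrm_minus_triangle:
  assumes "x \<in> carrier A" "y \<in> carrier A" "z \<in> carrier A"
  shows "nrm A (x \<ominus> z) \<le> nrm A (x \<ominus> y) + nrm A (y \<ominus> z)"
  using nrm_triangle[of "x \<ominus> y" "y \<ominus> z"] assms by (simp flip: minus_add_minus)

lemma nrm_le_minus:
  assumes "x \<in> carrier A" "y \<in> carrier A"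
  shows "nrm A x \<le> nrm A y + nrm A (x \<ominus> y)"
  using nrm_triangle[of "x \<ominus> y" y] assms by (simp add: ring_simprules)

lemma minus_self: "x \<in> carrier A \<Longrightarrow> x \<ominus> x = \<zero>"
  by (simp add: ring_simprules)

lemma minus_eq_zero_iff: "\<lbrakk>x \<in> carrier A; y \<in> carrier A\<rbrakk> \<Longrightarrow> x \<ominus> y = \<zero> \<longleftrightarrow> x = y"
  by (metis minus_equality minus_minus minus_self a_inv_closed a_minus_def)

text \<open>The C*-identity and submultiplicativity bound the square of the norm of \<open>x\<close>
  by the product of the norms of \<open>adj A x\<close> and \<open>x\<close>. Cancelling gives one
  inequality, and applying it to \<open>adj A x\<close> gives the other.\<close>

lemma nrm_adj: assumes x: "x \<in> carrier A" shows "nrm A (adj A x) = nrm A x"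
proof -
  have le: "nrm A x \<le> nrm A (adj A x)" if x: "x \<in> carrier A" for x
  proof (cases "nrm A x = 0")
    case False
    have "nrm A x * nrm A x \<le> nrm A (adj A x) * nrm A x"
      using nrm_mult[of "adj A x" x] x by (simp add: cstar_identity power2_eq_square)
    then show ?thesis
      using False nrm_nonneg[OF x] by (auto simp: mult_le_cancel_right)
  qed (use x nrm_nonneg in simp)
  from le[OF x] le[of "adj A x"] x show ?thesis
    by (simp add: adj_adj)
qed

lemma cstar_identity': "x \<in> carrier A \<Longrightarrow> nrm A (x \<otimes> adj A x) = (nrm A x)\<^sup>2"
  using cstar_identity[of "adj A x"] by (simp add: adj_adj nrm_adj)

text \<open>Telescoping: \<open>ab - a'b' = (a - a')b + a'(b - b')\<close>.\<close>

lemma nrm_mult_minus_le: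
  assumes "a \<in> carrier A" "b \<in> carrier A" "a' \<in> carrier A" "b' \<in> carrier A"
  shows "nrm A (a \<otimes> b \<ominus> a' \<otimes> b') \<le> nrm A (a \<ominus> a') * nrm A b + nrm A a' * nrm A (b \<ominus> b')"
proof -
  have "a \<otimes> b \<ominus> a' \<otimes> b' = (a \<ominus> a') \<otimes> b \<oplus> a' \<otimes> (b \<ominus> b')"
    using assms by (simp add: ring_simprules)
  then have "nrm A (a \<otimes> b \<ominus> a' \<otimes> b') \<le> nrm A ((a \<ominus> a') \<otimes> b) + nrm A (a' \<otimes> (b \<ominus> b'))"
    using assms by (simp add: nrm_triangle)
  also have "\<dots> \<le> nrm A (a \<ominus> a') * nrm A b + nrm A a' * nrm A (b \<ominus> b')"
    using assms by (intro add_mono nrm_mult) auto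
  finally show ?thesis .
qed

section \<open>Norms of projections and partial isometries\<close>

text \<open>Since \<open>p = p*p\<close>, the C*-identity makes the norm of \<open>p\<close>
  idempotent, that is 0 or 1.\<close>

lemma projection_nrm:
  assumes "is_projection A p" shows "nrm A p = (nrm A p)\<^sup>2" "nrm A p \<le> 1"
proof -
  from assms have p: "p \<in> carrier A" "adj A p \<otimes> p = p"
    by (auto simp: is_projection_def)
  then show eq: "nrm A p = (nrm A p)\<^sup>2"
    using cstar_identity[of p] by simp
  then show "nrm A p \<le> 1"
    by (metis mult_cancel_left2 nrm_nonneg p(1) power2_eq_square order_refl zero_le_one)
qed

text \<open>For \<open>q\<close> below \<open>p\<close> the difference \<open>p - q\<close> is again
  a projection, and it is nonzero. Such a gap of size 1 cannot vanish when passing to the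
  hull.\<close>

lemma nrm_projection_diff:
  assumes p: "is_projection A p" and q: "is_projection A q"
    and le: "proj_le A q p" and "q \<noteq> p"
  shows "nrm A (q \<ominus> p) = 1"
proof -
  have c: "p \<in> carrier A" "q \<in> carrier A" "p \<otimes> p = p" "q \<otimes> q = q" "adj A p = p" "adj A q = q"
    "p \<otimes> q = q" "q \<otimes> p = q"
    using p q le by (auto simp: is_projection_def proj_le_def)
  then have "is_projection A (p \<ominus> q)"
    by (simp add: is_projection_def adj_minus) (simp add: ring_simprules)
  from projection_nrm(1)[OF this] have "nrm A (p \<ominus> q) = 0 \<or> nrm A (p \<ominus> q) = 1"
    by (auto simp: power2_eq_square)
  then show ?thesis
    using c \<open>q \<noteq> p\<close> by (auto simp: nrm_eq_0 minus_eq_zero_iff nrm_minus_commute[of q p])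
qed

lemma partial_isometry_nrm:
  assumes "u \<in> carrier A" "is_projection A (adj A u \<otimes> u)"
  shows "nrm A u \<le> 1"
  using projection_nrm(2)[OF assms(2)] cstar_identity[OF assms(1)] nrm_nonneg[OF assms(1)]
  by (simp add: power_le_one_iff abs_square_le_1)

section \<open>Newton iteration towards an exact isometry\<close>

lemma limit_of_geometric:
  assumes s: "\<And>n. s n \<in> carrier A" and step: "\<And>n. nrm A (s (Suc n) \<ominus> s n) \<le> c * (1/2) ^ n"
  obtains l where "l \<in> carrier A" "(\<lambda>n. nrm A (s n \<ominus> l)) \<longlonglongrightarrow> 0" "nrm A (s 0 \<ominus> l) \<le> 2 * c"
proof -
  have c: "0 \<le> c"
    using step[of 0] nrm_nonneg[of "s 1 \<ominus> s 0"] s by simp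
  \<comment> \<open>The exact partial sum of the geometric series is carried along, since the
    coarser bound without the factor \<open>1 - (1/2) ^ k\<close> would not reproduce itself in the
    induction.\<close>
  have bound: "nrm A (s (n + k) \<ominus> s n) \<le> 2 * c * (1/2) ^ n * (1 - (1/2) ^ k)" for n k
  proof (induction k)
    case (Suc k)
    have "nrm A (s (n + Suc k) \<ominus> s n)
        \<le> nrm A (s (Suc (n + k)) \<ominus> s (n + k)) + nrm A (s (n + k) \<ominus> s n)"
      using nrm_minus_triangle[OF s s s] by simp
    also have "\<dots> \<le> c * (1/2) ^ (n + k) + 2 * c * (1/2) ^ n * (1 - (1/2) ^ k)"
      using step Suc by (intro add_mono) auto
    also have "\<dots> = 2 * c * (1/2) ^ n * (1 - (1/2) ^ Suc k)"
      by (simp add: power_add algebra_simps)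
    finally show ?case .
  qed (simp add: s minus_self)
  have bound': "nrm A (s m \<ominus> s n) \<le> 2 * c * (1/2) ^ n" if le: "n \<le> m" for m n
  proof -
    obtain k where "m = n + k" using le_Suc_ex[OF le] by blast
    moreover have "2 * c * (1/2) ^ n * (1 - (1/2) ^ k) \<le> 2 * c * (1/2) ^ n * 1"
      using c by (intro mult_left_mono) auto
    ultimately show ?thesis using bound[of n k] by simp
  qed
  have "\<exists>N. \<forall>m\<ge>N. \<forall>n\<ge>N. nrm A (s m \<ominus> s n) < e" if "e > 0" for e
  proof -
    have "(\<lambda>n. 2 * c * (1/2) ^ n) \<longlonglongrightarrow> 2 * c * 0"
      by (intro tendsto_intros LIMSEQ_power_zero) auto
    then have "eventually (\<lambda>n. 2 * c * (1/2) ^ n < e) sequentially"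
      using that by (intro order_tendstoD(2)) auto
    then obtain N where N: "\<And>n. n \<ge> N \<Longrightarrow> 2 * c * (1/2) ^ n < e"
      by (auto simp: eventually_sequentially)
    have "nrm A (s m \<ominus> s n) < e" if "m \<ge> N" "n \<ge> N" for m n
    proof (cases "n \<le> m")
      case True
      show ?thesis using bound'[OF True] N[OF that(2)] by linarith
    next
      case False
      then show ?thesis
        using bound'[of m n] N[OF that(1)] nrm_minus_commute[OF s s, of m n] by linarith
    qed
    then show ?thesis by blast
  qed
  from complete[of s, OF s this]
  obtain l where l: "l \<in> carrier A" "(\<lambda>n. nrm A (s n \<ominus> l)) \<longlonglongrightarrow> 0"
    by blast
  have "nrm A (s 0 \<ominus> l) \<le> 2 * c + nrm A (s n \<ominus> l)" for n
    using nrm_minus_triangle[OF s[of 0] s[of n] l(1)] bound'[of 0 n] nrm_minus_commute[OF s s, of 0 n]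
    by simp
  moreover have "(\<lambda>n. 2 * c + nrm A (s n \<ominus> l)) \<longlonglongrightarrow> 2 * c + 0"
    by (rule tendsto_add[OF tendsto_const l(2)])
  ultimately have "nrm A (s 0 \<ominus> l) \<le> 2 * c"
    using LIMSEQ_le_const[of _ "2 * c + 0"] by auto
  with l that show ?thesis by blast
qed

text \<open>With \<open>u*u = p - 2h\<close> and \<open>u' = u (1 + h)\<close>, the new error \<open>p - u'*u'\<close> equals
  \<open>3h\<^sup>2 + 2h\<^sup>3\<close>.\<close>

lemma newton_step:
  assumes p: "is_projection A p" and u: "u \<in> carrier A" "p \<otimes> u = u" "u \<otimes> p = u"
  defines "h \<equiv> (1/2) \<odot> (p \<ominus> adj A u \<otimes> u)"
  defines "u' \<equiv> u \<oplus> u \<otimes> h"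
  shows "u' \<in> carrier A" "p \<otimes> u' = u'" "u' \<otimes> p = u'"
    and "nrm A h = nrm A (p \<ominus> adj A u \<otimes> u) / 2"
    and "nrm A (p \<ominus> adj A u' \<otimes> u') \<le> 3 * (nrm A h)\<^sup>2 + 2 * (nrm A h) ^ 3"
    and "nrm A (u' \<ominus> u) \<le> nrm A u * nrm A h"
proof -
  have c: "p \<in> carrier A" "p \<otimes> p = p" "adj A p = p"
    using p by (auto simp: is_projection_def)
  let ?v = "adj A u" and ?e = "p \<ominus> adj A u \<otimes> u"
  have v: "?v \<in> carrier A" "p \<otimes> ?v = ?v" "?v \<otimes> p = ?v"
    using u c adj_mult[of u p] adj_mult[of p u] by auto
  have pe: "p \<otimes> ?e = ?e" "?e \<otimes> p = ?e" "adj A ?e = ?e"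
    using u c v by (simp_all add: minus_eq r_distr l_distr r_minus l_minus adj_add adj_uminus adj_mult adj_adj
        m_assoc flip: m_assoc[of p ?v u])
  have h: "h \<in> carrier A" "p \<otimes> h = h" "h \<otimes> p = h" "adj A h = h" "h \<oplus> h = ?e"
    using u c v pe smult_add_left[of ?e "1/2" "1/2"]
    by (simp_all add: h_def smult_mult_right smult_mult_left adj_smult smult_unit)
  have a: "?v \<otimes> u = p \<ominus> (h \<oplus> h)"
    using c u v by (simp add: h(5)) (simp add: ring_simprules)
  have hp: "p \<otimes> (h \<otimes> x) = h \<otimes> x" "h \<otimes> (p \<otimes> x) = h \<otimes> x" if "x \<in> carrier A" for x
    using that c h by (simp_all flip: m_assoc)
  show u': "u' \<in> carrier A" "p \<otimes> u' = u'" "u' \<otimes> p = u'"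
    using u c h by (simp_all add: u'_def r_distr l_distr m_assoc) (simp flip: m_assoc)
  show nh: "nrm A h = nrm A ?e / 2"
    using u c by (simp add: h_def nrm_smult)
  \<comment> \<open>As \<open>h\<close> is self-adjoint and \<open>p\<close> acts on it as a unit,
    the product is \<open>(1 + h)(p - 2h)(1 + h)\<close>, in which the terms linear in
    \<open>h\<close> cancel.\<close>
  have "adj A u' \<otimes> u' = ?v \<otimes> u \<oplus> (?v \<otimes> u) \<otimes> h \<oplus> h \<otimes> (?v \<otimes> u) \<oplus> h \<otimes> (?v \<otimes> u) \<otimes> h"
    using u c v h by (simp add: u'_def adj_add adj_mult r_distr l_distr a_ac m_assoc)
  also have "\<dots> = p \<ominus> (h \<otimes> h \<oplus> h \<otimes> h \<oplus> h \<otimes> h \<oplus> (h \<otimes> h \<otimes> h \<oplus> h \<otimes> h \<otimes> h))"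
  proof -
    have hx: "h \<oplus> (p \<oplus> (\<ominus> h \<oplus> x)) = p \<oplus> x" if "x \<in> carrier A" for x
      using that c h(1) by (simp add: a_lcomm[of h p] r_neg2)
    show ?thesis
      unfolding a using c h(1-4) hp by (simp add: ring_simprules hx)
  qed
  finally have e': "p \<ominus> adj A u' \<otimes> u' = h \<otimes> h \<oplus> h \<otimes> h \<oplus> h \<otimes> h \<oplus> (h \<otimes> h \<otimes> h \<oplus> h \<otimes> h \<otimes> h)"
    using c h by (simp add: ring_simprules)
  have hh: "nrm A (h \<otimes> h) \<le> (nrm A h)\<^sup>2"
    using nrm_mult[OF h(1) h(1)] by (simp add: power2_eq_square)
  moreover have "nrm A (h \<otimes> h \<otimes> h) \<le> (nrm A h) ^ 3"
  proof -
    have "nrm A (h \<otimes> h \<otimes> h) \<le> nrm A (h \<otimes> h) * nrm A h"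
      using h by (intro nrm_mult) auto
    also have "\<dots> \<le> (nrm A h)\<^sup>2 * nrm A h"
      using hh nrm_nonneg[OF h(1)] by (intro mult_right_mono) auto
    finally show ?thesis by (simp add: eval_nat_numeral)
  qed
  moreover have "nrm A (h \<otimes> h \<oplus> h \<otimes> h \<oplus> h \<otimes> h \<oplus> (h \<otimes> h \<otimes> h \<oplus> h \<otimes> h \<otimes> h))
     \<le> 3 * nrm A (h \<otimes> h) + 2 * nrm A (h \<otimes> h \<otimes> h)"
    using h(1) nrm_triangle[of "h \<otimes> h \<oplus> h \<otimes> h \<oplus> h \<otimes> h" "h \<otimes> h \<otimes> h \<oplus> h \<otimes> h \<otimes> h"]
      nrm_triangle[of "h \<otimes> h \<oplus> h \<otimes> h" "h \<otimes> h"] nrm_triangle[of "h \<otimes> h" "h \<otimes> h"]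
      nrm_triangle[of "h \<otimes> h \<otimes> h" "h \<otimes> h \<otimes> h"]
    by simp
  ultimately show "nrm A (p \<ominus> adj A u' \<otimes> u') \<le> 3 * (nrm A h)\<^sup>2 + 2 * (nrm A h) ^ 3"
    unfolding e' using hh by linarith
  have "u' \<ominus> u = u \<otimes> h"
    using u h by (simp add: u'_def ring_simprules)
  then show "nrm A (u' \<ominus> u) \<le> nrm A u * nrm A h"
    using u h nrm_mult by simp
qed

text \<open>The square of the norm of \<open>u\<close> is the norm of \<open>u*u\<close>, hence at
  most the norm of \<open>p\<close> plus 1, that is at most 2. The bound 2 for the norm itself is
  deliberately crude.\<close>

lemma nrm_le_2:
  assumes "is_projection A p" "u \<in> carrier A" "nrm A (p \<ominus> adj A u \<otimes> u) \<le> 1"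
  shows "nrm A u \<le> 2"
proof -
  have p: "p \<in> carrier A"
    using assms by (simp add: is_projection_def)
  have "(nrm A u)\<^sup>2 \<le> nrm A p + nrm A (adj A u \<otimes> u \<ominus> p)"
    using nrm_le_minus[of "adj A u \<otimes> u" p] p assms(2) by (simp add: cstar_identity)
  also have "\<dots> \<le> 2\<^sup>2"
    using projection_nrm(2)[OF assms(1)] assms nrm_minus_commute[of "adj A u \<otimes> u" p] p by simp
  finally show ?thesis
    by (rule power2_le_imp_le) simp
qed

text \<open>An error of at most 1/2 is at least halved by each Newton step, and a step moves the
  iterate by at most the current error. The iterates therefore converge, within total distance
  \<open>2 * d\<close>, to a point where the error is zero.\<close>

lemma nearby_isometry:
  assumes p: "is_projection A p" and w: "w \<in> carrier A" "p \<otimes> w = w" "w \<otimes> p = w"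
    and d: "nrm A (p \<ominus> adj A w \<otimes> w) \<le> d" "d \<le> 1/2"
  obtains u where "u \<in> carrier A" "adj A u \<otimes> u = p" "p \<otimes> u = u" "nrm A (w \<ominus> u) \<le> 2 * d"
proof -
  define step where "step u = u \<oplus> u \<otimes> ((1/2) \<odot> (p \<ominus> adj A u \<otimes> u))" for u
  define s where "s n = (step ^^ n) w" for n
  have s_simps: "s 0 = w" "s (Suc n) = step (s n)" for n
    by (simp_all add: s_def)
  have pc: "p \<in> carrier A"
    using p by (simp add: is_projection_def)
  \<comment> \<open>Here \<open>t\<close> stands for the current error, so that \<open>h\<close> has
    norm \<open>t / 2\<close>; factoring out \<open>t\<close> exposes the contraction ratio.\<close>
  have cubic: "3 * (t / 2)\<^sup>2 + 2 * (t / 2) ^ 3 = t * (3/4 * t + 1/4 * (t * t))" for t :: real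
    by (simp add: power2_eq_square power3_eq_cube field_simps)
  let ?e = "\<lambda>n. nrm A (p \<ominus> adj A (s n) \<otimes> s n)"
  have "0 \<le> d"
    using nrm_nonneg[of "p \<ominus> adj A w \<otimes> w"] pc w d by simp
  have inv: "s n \<in> carrier A \<and> p \<otimes> s n = s n \<and> s n \<otimes> p = s n \<and> ?e n \<le> d * (1/2) ^ n" for n
  proof (induction n)
    case (Suc n)
    then have c: "s n \<in> carrier A" "p \<otimes> s n = s n" "s n \<otimes> p = s n" "?e n \<le> d * (1/2) ^ n"
      by auto
    note st = newton_step[OF p c(1-3), folded step_def s_simps(2)]
    have "d * (1/2) ^ n \<le> 1/2 * 1"
      using \<open>0 \<le> d\<close> d by (intro mult_mono) (auto simp: power_le_one)
    with c(4) have e: "0 \<le> ?e n" "?e n \<le> 1/2"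
      using pc c(1) nrm_nonneg by auto
    have "?e (Suc n) \<le> 3 * (?e n / 2)\<^sup>2 + 2 * (?e n / 2) ^ 3"
      using st(5) unfolding st(4) .
    also have "\<dots> = ?e n * (3/4 * ?e n + 1/4 * (?e n * ?e n))"
      using cubic[of "?e n"] .
    \<comment> \<open>The ratio is at most 3/8 + 1/16 = 7/16 < 1/2; this is where the bound 1/2 on
      \<open>d\<close> enters.\<close>
    also have "\<dots> \<le> ?e n * (3/4 * (1/2) + 1/4 * (1/2 * (1/2)))"
      using e by (intro mult_left_mono add_mono mult_mono) auto
    also have "\<dots> \<le> (d * (1/2) ^ n) * (1/2)"
      using e c(4) by (intro mult_mono) auto
    finally show ?case
      using st by simp
  qed (use w d in \<open>auto simp: s_simps\<close>)
  have sc: "s n \<in> carrier A" for n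
    using inv by blast
  have e_le: "?e n \<le> d * (1/2) ^ n" and e1: "?e n \<le> 1" for n
  proof -
    show "?e n \<le> d * (1/2) ^ n" using inv by blast
    also have "\<dots> \<le> 1 * 1"
      using \<open>0 \<le> d\<close> d by (intro mult_mono) (auto simp: power_le_one)
    finally show "?e n \<le> 1" by simp
  qed
  have s2: "nrm A (s n) \<le> 2" for n
    by (rule nrm_le_2[OF p sc e1])
  have "nrm A (s (Suc n) \<ominus> s n) \<le> d * (1/2) ^ n" for n
  proof -
    have c: "s n \<in> carrier A" "p \<otimes> s n = s n" "s n \<otimes> p = s n"
      using inv by auto
    note st = newton_step[OF p c, folded step_def s_simps(2)]
    have "nrm A (s (Suc n) \<ominus> s n) \<le> nrm A (s n) * (?e n / 2)"
      using st(6) unfolding st(4) .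
    also have "\<dots> \<le> 2 * (?e n / 2)"
      using s2 pc sc nrm_nonneg by (intro mult_right_mono) auto
    finally show ?thesis
      using e_le[of n] by simp
  qed
  from limit_of_geometric[OF sc this]
  obtain u where u: "u \<in> carrier A" "(\<lambda>n. nrm A (s n \<ominus> u)) \<longlonglongrightarrow> 0" "nrm A (s 0 \<ominus> u) \<le> 2 * d"
    by blast
  \<comment> \<open>Continuity is used quantitatively: each equation for the limit \<open>u\<close>
    follows from estimates against \<open>s n\<close> that tend to zero.\<close>
  have eq_if: "x = y" if "x \<in> carrier A" "y \<in> carrier A" "\<And>n. nrm A (x \<ominus> y) \<le> f n" "f \<longlonglongrightarrow> 0"
    for x y and f :: "nat \<Rightarrow> real"
  proof -
    have "nrm A (x \<ominus> y) \<le> 0"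
      using LIMSEQ_le_const[OF that(4)] that(3) by blast
    then show ?thesis
      using nrm_nonneg[of "x \<ominus> y"] that minus_eq_zero_iff nrm_eq_0[of "x \<ominus> y"] by auto
  qed
  have us: "nrm A (u \<ominus> s n) = nrm A (s n \<ominus> u)" for n
    using nrm_minus_commute sc u(1) by blast
  have "p \<otimes> u = u"
  proof (rule eq_if)
    fix n
    have "nrm A (p \<otimes> u \<ominus> u) \<le> nrm A (p \<otimes> u \<ominus> p \<otimes> s n) + nrm A (s n \<ominus> u)"
      using nrm_minus_triangle[of "p \<otimes> u" "p \<otimes> s n" u] inv[of n] pc u(1) by simp
    also have "\<dots> \<le> 2 * nrm A (s n \<ominus> u)"
      using nrm_mult_minus_le[of p u p "s n"] pc u(1) sc[of n] us[of n] projection_nrm(2)[OF p]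
        mult_right_mono[of "nrm A p" 1 "nrm A (s n \<ominus> u)"] nrm_nonneg[of "s n \<ominus> u"]
      by (simp add: minus_self)
    finally show "nrm A (p \<otimes> u \<ominus> u) \<le> 2 * nrm A (s n \<ominus> u)" .
  next
    show "(\<lambda>n. 2 * nrm A (s n \<ominus> u)) \<longlonglongrightarrow> 0"
      using tendsto_mult_left[OF u(2), of 2] by simp
  qed (use pc u in auto)
  moreover have "adj A u \<otimes> u = p"
  proof (rule eq_if)
    fix n
    have "nrm A (adj A u \<otimes> u \<ominus> p) \<le> nrm A (adj A u \<otimes> u \<ominus> adj A (s n) \<otimes> s n) + ?e n"
      using nrm_minus_triangle[of "adj A u \<otimes> u" "adj A (s n) \<otimes> s n" p]
        nrm_minus_commute[of p "adj A (s n) \<otimes> s n"] sc[of n] pc u(1) by simp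
    also have "nrm A (adj A u \<otimes> u \<ominus> adj A (s n) \<otimes> s n)
        \<le> nrm A (u \<ominus> s n) * nrm A u + nrm A (s n) * nrm A (u \<ominus> s n)"
      using nrm_mult_minus_le[of "adj A u" u "adj A (s n)" "s n"] u(1) sc[of n]
        nrm_adj[of "u \<ominus> s n"] by (simp add: adj_minus nrm_adj)
    also have "nrm A (s n) * nrm A (u \<ominus> s n) \<le> 2 * nrm A (u \<ominus> s n)"
      using s2 u(1) sc nrm_nonneg by (intro mult_right_mono) auto
    also have "?e n \<le> d * (1/2) ^ n"
      by (rule e_le)
    finally show "nrm A (adj A u \<otimes> u \<ominus> p) \<le>
        nrm A (s n \<ominus> u) * nrm A u + 2 * nrm A (s n \<ominus> u) + d * (1/2) ^ n"
      by (simp add: us)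
  next
    have "(\<lambda>n. nrm A (s n \<ominus> u) * nrm A u + 2 * nrm A (s n \<ominus> u) + d * (1/2) ^ n)
        \<longlonglongrightarrow> 0 * nrm A u + 2 * 0 + d * 0"
      by (intro tendsto_intros u(2) LIMSEQ_power_zero) auto
    then show "(\<lambda>n. nrm A (s n \<ominus> u) * nrm A u + 2 * nrm A (s n \<ominus> u) + d * (1/2) ^ n) \<longlonglongrightarrow> 0"
      by simp
  qed (use pc u in auto)
  ultimately show ?thesis
    using that u by (simp add: s_simps)
qed

section \<open>From approximate data to an infinite projection\<close>

text \<open>The equation \<open>u*u = p\<close> forces \<open>up = u\<close>, which makes
  \<open>uu*\<close> a projection, and \<open>pu = u\<close> puts it below \<open>p\<close>.\<close>

lemma infinite_projectionI:
  assumes p: "is_projection A p" and u: "u \<in> carrier A" "adj A u \<otimes> u = p" "p \<otimes> u = u"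
    and ne: "u \<otimes> adj A u \<noteq> p"
  shows "infinite_projection A p"
proof -
  have c: "p \<in> carrier A" "p \<otimes> p = p" "adj A p = p"
    using p by (auto simp: is_projection_def)
  have vp: "adj A u \<otimes> p = adj A u"
    using adj_mult[of p u] u c by simp
  have up: "u \<otimes> p = u"
  proof -
    \<comment> \<open>By the C*-identity it is enough that this product vanishes; with
      \<open>u*u = p\<close> it becomes \<open>p - p - p + p\<close>.\<close>
    have "adj A (u \<otimes> p \<ominus> u) \<otimes> (u \<otimes> p \<ominus> u) = \<zero>"
    proof -
      have "adj A (u \<otimes> p \<ominus> u) \<otimes> (u \<otimes> p \<ominus> u) = p \<otimes> (adj A u \<otimes> u) \<otimes> p \<ominus> p \<otimes> (adj A u \<otimes> u) \<ominus> (adj A u \<otimes> u) \<otimes> p \<oplus> adj A u \<otimes> u"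
        using u(1) c by (simp add: adj_minus adj_mult) (simp add: ring_simprules)
      then show ?thesis
        using c by (simp add: u ring_simprules)
    qed
    then show ?thesis
      using u c cstar_identity[of "u \<otimes> p \<ominus> u"] by (simp add: nrm_eq_0 minus_eq_zero_iff)
  qed
  have "u \<otimes> adj A u \<otimes> (u \<otimes> adj A u) = u \<otimes> (adj A u \<otimes> u) \<otimes> adj A u"
    using u(1) by (simp add: m_assoc)
  also have "\<dots> = u \<otimes> adj A u"
    by (simp add: u(2) up)
  finally have q: "is_projection A (u \<otimes> adj A u)"
    using u(1) by (simp add: is_projection_def adj_mult adj_adj)
  moreover have "mvn_equiv A p (u \<otimes> adj A u)"
    unfolding mvn_equiv_def partial_isometry_def using p u by auto
  moreover have "proj_le A (u \<otimes> adj A u) p"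
    using u c vp by (simp add: proj_le_def m_assoc) (simp flip: m_assoc)
  ultimately show ?thesis
    unfolding infinite_projection_def using p ne by blast
qed

text \<open>The hypotheses are of order \<open>s\<^sup>2\<close> because the C*-identity yields
  squares of norms, so that \<open>v\<close> itself is within order \<open>s\<close> of the corner
  of \<open>p\<close>. The factor 200 leaves room for the accumulated error
  \<open>152 * s\<close>.\<close>

lemma infinite_projection_perturb:
  assumes p: "is_projection A p" and v: "v \<in> carrier A" and s: "0 < s" "200 * s \<le> \<eta>" "200 * s \<le> 1"
    and vv: "nrm A (adj A v \<otimes> v \<ominus> p) \<le> s\<^sup>2"
    and pvv: "nrm A (p \<otimes> (v \<otimes> adj A v) \<ominus> v \<otimes> adj A v) \<le> s\<^sup>2"
    and far: "\<eta> \<le> nrm A (v \<otimes> adj A v \<ominus> p)"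
  shows "infinite_projection A p"
proof -
  have c: "p \<in> carrier A" "p \<otimes> p = p" "adj A p = p"
    using p by (auto simp: is_projection_def)
  note p1 = projection_nrm(2)[OF p] and p0 = nrm_nonneg[OF c(1)]
  have pp: "p \<otimes> (p \<otimes> x) = p \<otimes> x" if "x \<in> carrier A" for x
    using that c by (simp flip: m_assoc)
  have np: "nrm A (x \<otimes> p) \<le> nrm A x" "nrm A (p \<otimes> x) \<le> nrm A x" if "x \<in> carrier A" for x
    using nrm_mult[of x p] nrm_mult[of p x] mult_left_mono[OF p1, of "nrm A x"]
      mult_right_mono[OF p1, of "nrm A x"] nrm_nonneg[OF that] that c by simp_all
  define k where "k = adj A v \<otimes> v \<ominus> p"
  have k: "k \<in> carrier A" "nrm A k \<le> s\<^sup>2" "adj A v \<otimes> v = p \<oplus> k"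
    using vv v c by (auto simp: k_def ring_simprules)
  have s1: "s\<^sup>2 \<le> 1 * s"
    using s unfolding power2_eq_square by (intro mult_right_mono) auto
  have s4: "(2 * s)\<^sup>2 = 4 * s\<^sup>2"
    by (simp add: power2_eq_square)
  have v2: "nrm A v \<le> 2"
    using vv s s1 nrm_minus_commute[of p "adj A v \<otimes> v"] v c by (intro nrm_le_2[OF p v]) auto
  \<comment> \<open>Writing \<open>v*v = p + k\<close>, the contributions of \<open>p\<close> cancel
    and four terms remain, each of norm at most that of \<open>k\<close>.\<close>
  have "adj A (v \<ominus> v \<otimes> p) \<otimes> (v \<ominus> v \<otimes> p) =
      (adj A v \<otimes> v) \<ominus> (adj A v \<otimes> v) \<otimes> p \<ominus> (p \<otimes> (adj A v \<otimes> v) \<ominus> p \<otimes> (adj A v \<otimes> v) \<otimes> p)"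
    using v c by (simp add: adj_minus adj_mult) (simp add: ring_simprules)
  also have "\<dots> = k \<ominus> k \<otimes> p \<ominus> (p \<otimes> k \<ominus> p \<otimes> k \<otimes> p)"
    using k(1) c pp unfolding k(3) by (simp add: ring_simprules)
  finally have "(nrm A (v \<ominus> v \<otimes> p))\<^sup>2 = nrm A (k \<ominus> k \<otimes> p \<ominus> (p \<otimes> k \<ominus> p \<otimes> k \<otimes> p))"
    using cstar_identity[of "v \<ominus> v \<otimes> p"] v c by simp
  also have "\<dots> \<le> 4 * nrm A k"
    using nrm_minus_le[of "k \<ominus> k \<otimes> p" "p \<otimes> k \<ominus> p \<otimes> k \<otimes> p"] nrm_minus_le[of k "k \<otimes> p"]
      nrm_minus_le[of "p \<otimes> k" "p \<otimes> k \<otimes> p"] np[of k] np[of "p \<otimes> k"] k(1) c by simp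
  also have "\<dots> \<le> (2 * s)\<^sup>2"
    using k(2) s4 by linarith
  finally have d1: "nrm A (v \<ominus> v \<otimes> p) \<le> 2 * s"
    by (rule power2_le_imp_le) (use s in simp)
  define l where "l = p \<otimes> (v \<otimes> adj A v) \<ominus> v \<otimes> adj A v"
  have l: "l \<in> carrier A" "nrm A l \<le> s\<^sup>2"
    using pvv v c by (auto simp: l_def)
  \<comment> \<open>On this side the defect is expressed through \<open>l = pvv* - vv*\<close>, so
    the second form of the C*-identity applies.\<close>
  have "(v \<ominus> p \<otimes> v) \<otimes> adj A (v \<ominus> p \<otimes> v) = l \<otimes> p \<ominus> l"
    using v c by (simp add: l_def adj_minus adj_mult) (simp add: ring_simprules)
  then have "(nrm A (v \<ominus> p \<otimes> v))\<^sup>2 = nrm A (l \<otimes> p \<ominus> l)"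
    using cstar_identity'[of "v \<ominus> p \<otimes> v"] v c by simp
  also have "\<dots> \<le> 2 * nrm A l"
    using nrm_minus_le[of "l \<otimes> p" l] np[of l] l(1) c by simp
  also have "\<dots> \<le> (2 * s)\<^sup>2"
    using l(2) s4 zero_le_power2[of s] by linarith
  finally have d2: "nrm A (v \<ominus> p \<otimes> v) \<le> 2 * s"
    by (rule power2_le_imp_le) (use s in simp)
  \<comment> \<open>Compression to the corner of \<open>p\<close>, where the Newton iteration can
    start.\<close>
  define w where "w = p \<otimes> v \<otimes> p"
  have w: "w \<in> carrier A" "p \<otimes> w = w" "w \<otimes> p = w"
    using v c pp by (auto simp: w_def m_assoc)
  have "nrm A (p \<otimes> v \<ominus> w) \<le> nrm A (v \<ominus> v \<otimes> p)"
  proof -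
    have "p \<otimes> v \<ominus> w = p \<otimes> (v \<ominus> v \<otimes> p)"
      using v c by (simp add: w_def ring_simprules)
    then show ?thesis using np v c by simp
  qed
  then have vw: "nrm A (v \<ominus> w) \<le> 4 * s"
    using d1 d2 nrm_minus_triangle[of v "p \<otimes> v" w] v c w by simp
  have w2: "nrm A w \<le> 2"
    using v2 np[of v] np[of "p \<otimes> v"] v c by (simp add: w_def)
  \<comment> \<open>On the ball of radius 2 the maps sending \<open>x\<close> to \<open>x*x\<close>
    and to \<open>xx*\<close> are Lipschitz with constant 4.\<close>
  have close: "nrm A (adj A x \<otimes> x \<ominus> adj A y \<otimes> y) \<le> 4 * r \<and> nrm A (x \<otimes> adj A x \<ominus> y \<otimes> adj A y) \<le> 4 * r"
    if xy: "x \<in> carrier A" "y \<in> carrier A" "nrm A x \<le> 2" "nrm A y \<le> 2" "nrm A (x \<ominus> y) \<le> r" for x y r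
  proof -
    have a: "nrm A (adj A x \<ominus> adj A y) = nrm A (x \<ominus> y)"
      using nrm_adj[of "x \<ominus> y"] xy by (simp add: adj_minus)
    have b: "nrm A (x \<ominus> y) * nrm A x \<le> r * 2" "nrm A y * nrm A (x \<ominus> y) \<le> 2 * r"
      using xy mult_mono[of "nrm A (x \<ominus> y)" r "nrm A x" 2] mult_mono[of "nrm A y" 2 "nrm A (x \<ominus> y)" r]
        nrm_nonneg[of "x \<ominus> y"] nrm_nonneg[of x] by simp_all
    then show ?thesis
      using nrm_mult_minus_le[of "adj A x" x "adj A y" y] nrm_mult_minus_le[of x "adj A x" y "adj A y"]
        xy a by (simp add: nrm_adj)
  qed
  have "nrm A (p \<ominus> adj A w \<otimes> w) \<le> nrm A (p \<ominus> adj A v \<otimes> v) + nrm A (adj A v \<otimes> v \<ominus> adj A w \<otimes> w)"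
    using v w c by (intro nrm_minus_triangle) auto
  \<comment> \<open>One \<open>s\<close> comes from \<open>s\<^sup>2 \<le> s\<close>, and
    \<open>16 * s\<close> from the Lipschitz bound at distance \<open>4 * s\<close>.\<close>
  also have "\<dots> \<le> 17 * s"
    using vv close[OF v w(1) v2 w2 vw] s1 nrm_minus_commute[of p "adj A v \<otimes> v"] v c by simp
  finally have d17: "nrm A (p \<ominus> adj A w \<otimes> w) \<le> 17 * s" .
  obtain u where u: "u \<in> carrier A" "adj A u \<otimes> u = p" "p \<otimes> u = u" "nrm A (w \<ominus> u) \<le> 2 * (17 * s)"
    by (rule nearby_isometry[OF p w d17]) (use s in simp)
  have u2: "nrm A u \<le> 2"
    using partial_isometry_nrm[OF u(1)] p u(2) by simp
  have "nrm A (v \<otimes> adj A v \<ominus> u \<otimes> adj A u) \<le>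
      nrm A (v \<otimes> adj A v \<ominus> w \<otimes> adj A w) + nrm A (w \<otimes> adj A w \<ominus> u \<otimes> adj A u)"
    using v w u by (intro nrm_minus_triangle) auto
  also have "\<dots> \<le> 4 * (4 * s) + 4 * (2 * (17 * s))"
    using close[OF v w(1) v2 w2 vw] close[OF w(1) u(1) w2 u2 u(4)] by linarith
  \<comment> \<open>The sum is \<open>152 * s\<close>, strictly below \<open>200 * s\<close> because
    \<open>s\<close> is positive.\<close>
  also have "\<dots> < \<eta>"
    using s by simp
  finally have "u \<otimes> adj A u \<noteq> p"
    using far by auto
  then show ?thesis
    by (rule infinite_projectionI[OF p u(1-3)])
qed

end

subsection \<open>Internal C*-algebras and their hulls\<close>

text \<open>Unspecified off \<open>OAlg\<close>; the ultrafilter guarantees that almost every first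
  entry has this form.\<close>

primrec the_alg :: "'x obj \<Rightarrow> (complex, 'x, real) star_alg" where
  "the_alg (OAlg A) = A"

primrec the_point :: "'x obj \<Rightarrow> 'x" where
  "the_point (OPoint a) = a"

definition alg :: "'x obj list \<Rightarrow> (complex, 'x, real) star_alg" where
  "alg xs = the_alg (xs ! 0)"

locale internal_cstar = transfer_universe U for U :: "('x obj, 'w) universe" +
  fixes M :: 'w
  assumes internal: "internal_cstar_algebra U M"
begin

abbreviation I where "I \<equiv> internal_alg U M"
abbreviation H where "H \<equiv> nonstandard_hull U M"
abbreviation F where "F ws \<equiv> frame U (M # ws)"

text \<open>The internal algebra \<open>M\<close> is always the first entry of the tuple.\<close>

definition pt :: "'w list \<Rightarrow> ('x obj list \<Rightarrow> 'x) \<Rightarrow> 'w" where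
  "pt ws f = val (M # ws) (\<lambda>xs. OPoint (f xs))"

definition rl :: "'w list \<Rightarrow> ('x obj list \<Rightarrow> real) \<Rightarrow> 'w" where
  "rl ws f = val (M # ws) (\<lambda>xs. OReal (f xs))"

abbreviation pts :: "'w list \<Rightarrow> ('x obj list \<Rightarrow> 'x) \<Rightarrow> bool" where
  "pts ws f \<equiv> eventually (\<lambda>xs. f xs \<in> carrier (alg xs)) (F ws)"

lemma eventually_alg:
  "eventually (\<lambda>xs. xs ! 0 = OAlg (alg xs) \<and> cstar_algebra (alg xs)) (F ws)"
proof -
  have "map (val (M # ws)) [\<lambda>xs. xs ! 0] \<in> ext U {[OAlg A] | A. cstar_algebra A}"
    using internal val_nth[of 0 "M # ws"] by (simp add: internal_cstar_algebra_def)
  then show ?thesis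
    unfolding map_val_in_ext by eventually_elim (auto simp: alg_def)
qed

lemma eventually_cstar: "eventually (\<lambda>xs. cstar_algebra (alg xs)) (F ws)"
  using eventually_alg by eventually_elim simp

lemma M_eq_val: "M = val (M # ws) (\<lambda>xs. OAlg (alg xs))"
proof -
  have "val (M # ws) (\<lambda>xs. xs ! 0) = val (M # ws) (\<lambda>xs. OAlg (alg xs))"
    unfolding val_eq_iff using eventually_alg by eventually_elim simp
  then show ?thesis
    using val_nth[of 0 "M # ws"] by simp
qed

lemma in_carrier_pt: "pt ws f \<in> carrier I \<longleftrightarrow> pts ws f"
proof -
  let ?R = "{[OAlg A, OPoint a] | A a. cstar_algebra A \<and> a \<in> carrier A}"
  have "pt ws f \<in> carrier I \<longleftrightarrow>
      map (val (M # ws)) [\<lambda>xs. OAlg (alg xs), \<lambda>xs. OPoint (f xs)] \<in> ext U ?R"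
    by (simp add: internal_alg_def pt_def flip: M_eq_val)
  also have "\<dots> \<longleftrightarrow> pts ws f"
    unfolding map_val_in_ext
    by (rule eventually_cong[OF eventually_cstar]) auto
  finally show ?thesis .
qed

lemma internally_pt:
  "internally U P M (pt ws f) \<longleftrightarrow>
   eventually (\<lambda>xs. f xs \<in> carrier (alg xs) \<and> P (alg xs) (f xs)) (F ws)"
proof -
  let ?R = "{[OAlg A, OPoint a] | A a. cstar_algebra A \<and> a \<in> carrier A \<and> P A a}"
  have "internally U P M (pt ws f) \<longleftrightarrow>
      map (val (M # ws)) [\<lambda>xs. OAlg (alg xs), \<lambda>xs. OPoint (f xs)] \<in> ext U ?R"
    by (simp add: internally_def pt_def flip: M_eq_val)
  also have "\<dots> \<longleftrightarrow> eventually (\<lambda>xs. f xs \<in> carrier (alg xs) \<and> P (alg xs) (f xs)) (F ws)"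
    unfolding map_val_in_ext
    by (rule eventually_cong[OF eventually_cstar]) auto
  finally show ?thesis .
qed

lemma internally_carrier: "internally U P M x \<Longrightarrow> x \<in> carrier I"
  unfolding internally_def internal_alg_def by (auto elim!: ext_impl[rotated])

text \<open>A member of the tuple is the value of a coordinate function, shifted by one because
  \<open>M\<close> is entry 0. Being in the carrier means that this coordinate is eventually a
  point, which \<open>the_point\<close> extracts.\<close>

lemma ptE:
  assumes "x \<in> carrier I" "x \<in> set ws"
  obtains f where "x = pt ws f" "pts ws f"
proof -
  let ?R = "{[OAlg A, OPoint a] | A a. cstar_algebra A \<and> a \<in> carrier A}"
  obtain i where i: "i < length ws" "x = ws ! i"
    using assms(2) by (auto simp: in_set_conv_nth)
  then have x: "x = val (M # ws) (\<lambda>xs. xs ! Suc i)"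
    using val_nth[of "Suc i" "M # ws"] by simp
  have "[M, x] \<in> ext U ?R"
    using assms(1) by (simp add: internal_alg_def)
  then have "map (val (M # ws)) [\<lambda>xs. OAlg (alg xs), \<lambda>xs. xs ! Suc i] \<in> ext U ?R"
    by (simp flip: M_eq_val x)
  then have *: "eventually (\<lambda>xs. xs ! Suc i = OPoint (the_point (xs ! Suc i)) \<and>
      the_point (xs ! Suc i) \<in> carrier (alg xs)) (F ws)"
    unfolding map_val_in_ext by eventually_elim auto
  have "x = pt ws (\<lambda>xs. the_point (xs ! Suc i))"
    unfolding x pt_def val_eq_iff using * by eventually_elim simp
  moreover from * have "pts ws (\<lambda>xs. the_point (xs ! Suc i))"
    by eventually_elim simp
  ultimately show ?thesis by (rule that)
qed

lemma pt_eq_iff: "pt ws f = pt ws g \<longleftrightarrow> eventually (\<lambda>xs. f xs = g xs) (F ws)"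
  by (simp add: pt_def val_eq_iff)

section \<open>Internal operations computed pointwise\<close>

text \<open>The extended graph of the product is functional in its last argument, and the pointwise
  product lies on it at almost every tuple. The other operations follow the same pattern.\<close>

lemma pt_mult:
  assumes "pts ws f" "pts ws g"
  shows "pt ws f \<otimes>\<^bsub>I\<^esub> pt ws g = pt ws (\<lambda>xs. f xs \<otimes>\<^bsub>alg xs\<^esub> g xs)"
    and "pts ws (\<lambda>xs. f xs \<otimes>\<^bsub>alg xs\<^esub> g xs)"
proof -
  let ?R = "{[OAlg A, OPoint a, OPoint b, OPoint (a \<otimes>\<^bsub>A\<^esub> b)] | A a b.
                cstar_algebra A \<and> a \<in> carrier A \<and> b \<in> carrier A}"
  have "(THE z. map (val (M # ws)) [\<lambda>xs. OAlg (alg xs), \<lambda>xs. OPoint (f xs), \<lambda>xs. OPoint (g xs)] @ [z] \<in> ext U ?R)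
    = val (M # ws) (\<lambda>xs. OPoint (f xs \<otimes>\<^bsub>alg xs\<^esub> g xs))"
  proof (rule the_ext_eq_val)
    show "eventually (\<lambda>xs. map (\<lambda>f. f xs) [\<lambda>xs. OAlg (alg xs), \<lambda>xs. OPoint (f xs), \<lambda>xs. OPoint (g xs)] @
        [OPoint (f xs \<otimes>\<^bsub>alg xs\<^esub> g xs)] \<in> ?R) (F ws)"
      using assms eventually_cstar by eventually_elim simp
  qed auto
  then show "pt ws f \<otimes>\<^bsub>I\<^esub> pt ws g = pt ws (\<lambda>xs. f xs \<otimes>\<^bsub>alg xs\<^esub> g xs)"
    by (simp add: internal_alg_def pt_def flip: M_eq_val)
  show "pts ws (\<lambda>xs. f xs \<otimes>\<^bsub>alg xs\<^esub> g xs)"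
    using assms eventually_cstar
    by eventually_elim (meson cstar_algebra.axioms(2) ring.ring_simprules(5))
qed

lemma pt_add:
  assumes "pts ws f" "pts ws g"
  shows "pt ws f \<oplus>\<^bsub>I\<^esub> pt ws g = pt ws (\<lambda>xs. f xs \<oplus>\<^bsub>alg xs\<^esub> g xs)"
    and "pts ws (\<lambda>xs. f xs \<oplus>\<^bsub>alg xs\<^esub> g xs)"
proof -
  let ?R = "{[OAlg A, OPoint a, OPoint b, OPoint (a \<oplus>\<^bsub>A\<^esub> b)] | A a b.
                cstar_algebra A \<and> a \<in> carrier A \<and> b \<in> carrier A}"
  have "(THE z. map (val (M # ws)) [\<lambda>xs. OAlg (alg xs), \<lambda>xs. OPoint (f xs), \<lambda>xs. OPoint (g xs)] @ [z] \<in> ext U ?R)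
    = val (M # ws) (\<lambda>xs. OPoint (f xs \<oplus>\<^bsub>alg xs\<^esub> g xs))"
  proof (rule the_ext_eq_val)
    show "eventually (\<lambda>xs. map (\<lambda>f. f xs) [\<lambda>xs. OAlg (alg xs), \<lambda>xs. OPoint (f xs), \<lambda>xs. OPoint (g xs)] @
        [OPoint (f xs \<oplus>\<^bsub>alg xs\<^esub> g xs)] \<in> ?R) (F ws)"
      using assms eventually_cstar by eventually_elim simp
  qed auto
  then show "pt ws f \<oplus>\<^bsub>I\<^esub> pt ws g = pt ws (\<lambda>xs. f xs \<oplus>\<^bsub>alg xs\<^esub> g xs)"
    by (simp add: internal_alg_def pt_def flip: M_eq_val)
  show "pts ws (\<lambda>xs. f xs \<oplus>\<^bsub>alg xs\<^esub> g xs)"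
    using assms eventually_cstar
    by eventually_elim (meson cstar_algebra.axioms(2) ring.ring_simprules(1))
qed

lemma pt_zero:
  shows "\<zero>\<^bsub>I\<^esub> = pt ws (\<lambda>xs. \<zero>\<^bsub>alg xs\<^esub>)" and "pts ws (\<lambda>xs. \<zero>\<^bsub>alg xs\<^esub>)"
proof -
  let ?R = "{[OAlg A, OPoint \<zero>\<^bsub>A\<^esub>] | A. cstar_algebra A}"
  have "(THE z. map (val (M # ws)) [\<lambda>xs. OAlg (alg xs)] @ [z] \<in> ext U ?R)
    = val (M # ws) (\<lambda>xs. OPoint \<zero>\<^bsub>alg xs\<^esub>)"
  proof (rule the_ext_eq_val)
    show "eventually (\<lambda>xs. map (\<lambda>f. f xs) [\<lambda>xs. OAlg (alg xs)] @ [OPoint \<zero>\<^bsub>alg xs\<^esub>] \<in> ?R) (F ws)"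
      using eventually_cstar by eventually_elim simp
  qed auto
  then show "\<zero>\<^bsub>I\<^esub> = pt ws (\<lambda>xs. \<zero>\<^bsub>alg xs\<^esub>)"
    by (simp add: internal_alg_def pt_def flip: M_eq_val)
  show "pts ws (\<lambda>xs. \<zero>\<^bsub>alg xs\<^esub>)"
    using eventually_cstar by eventually_elim (meson cstar_algebra.axioms(2) ring.ring_simprules(2))
qed

lemma pt_adj:
  assumes "pts ws f"
  shows "adj I (pt ws f) = pt ws (\<lambda>xs. adj (alg xs) (f xs))"
    and "pts ws (\<lambda>xs. adj (alg xs) (f xs))"
proof -
  let ?R = "{[OAlg A, OPoint a, OPoint (adj A a)] | A a. cstar_algebra A \<and> a \<in> carrier A}"
  have "(THE z. map (val (M # ws)) [\<lambda>xs. OAlg (alg xs), \<lambda>xs. OPoint (f xs)] @ [z] \<in> ext U ?R)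
    = val (M # ws) (\<lambda>xs. OPoint (adj (alg xs) (f xs)))"
  proof (rule the_ext_eq_val)
    show "eventually (\<lambda>xs. map (\<lambda>f. f xs) [\<lambda>xs. OAlg (alg xs), \<lambda>xs. OPoint (f xs)] @
        [OPoint (adj (alg xs) (f xs))] \<in> ?R) (F ws)"
      using assms eventually_cstar by eventually_elim simp
  qed auto
  then show "adj I (pt ws f) = pt ws (\<lambda>xs. adj (alg xs) (f xs))"
    by (simp add: internal_alg_def pt_def flip: M_eq_val)
  show "pts ws (\<lambda>xs. adj (alg xs) (f xs))"
    using assms eventually_cstar by eventually_elim (rule cstar_algebra.adj_closed)
qed

lemma pt_nrm:
  assumes "pts ws f"
  shows "nrm I (pt ws f) = rl ws (\<lambda>xs. nrm (alg xs) (f xs))"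
proof -
  let ?R = "{[OAlg A, OPoint a, OReal (nrm A a)] | A a. cstar_algebra A \<and> a \<in> carrier A}"
  have "(THE z. map (val (M # ws)) [\<lambda>xs. OAlg (alg xs), \<lambda>xs. OPoint (f xs)] @ [z] \<in> ext U ?R)
    = val (M # ws) (\<lambda>xs. OReal (nrm (alg xs) (f xs)))"
  proof (rule the_ext_eq_val)
    show "eventually (\<lambda>xs. map (\<lambda>f. f xs) [\<lambda>xs. OAlg (alg xs), \<lambda>xs. OPoint (f xs)] @
        [OReal (nrm (alg xs) (f xs))] \<in> ?R) (F ws)"
      using assms eventually_cstar by eventually_elim simp
  qed auto
  then show ?thesis
    by (simp add: internal_alg_def pt_def rl_def flip: M_eq_val)
qed

text \<open>Subtraction in \<open>I\<close> is derived from inverses in its additive monoid and is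
  not an extended graph. The group laws make these inverses unique, so that they can be
  identified.\<close>

lemma abelian_group_internal: "abelian_group I"
proof (rule abelian_groupI)
  fix x y assume x: "x \<in> carrier I" and y: "y \<in> carrier I"
  let ?ws = "[x, y]"
  from ptE[OF x, of ?ws] obtain f where f: "x = pt ?ws f" "pts ?ws f" by auto
  from ptE[OF y, of ?ws] obtain g where g: "y = pt ?ws g" "pts ?ws g" by auto
  show "x \<oplus>\<^bsub>I\<^esub> y \<in> carrier I"
    using pt_add[OF f(2) g(2)] by (simp add: in_carrier_pt flip: f(1) g(1))
  have "eventually (\<lambda>xs. f xs \<oplus>\<^bsub>alg xs\<^esub> g xs = g xs \<oplus>\<^bsub>alg xs\<^esub> f xs) (F ?ws)"
    using f(2) g(2) eventually_cstar
    by eventually_elim (meson cstar_algebra.axioms(2) ring.ring_simprules(10))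
  then show "x \<oplus>\<^bsub>I\<^esub> y = y \<oplus>\<^bsub>I\<^esub> x"
    using pt_add(1)[OF f(2) g(2)] pt_add(1)[OF g(2) f(2)] by (simp add: pt_eq_iff flip: f(1) g(1))
next
  show "\<zero>\<^bsub>I\<^esub> \<in> carrier I"
    using pt_zero[of "[]"] by (simp add: in_carrier_pt)
next
  fix x y z assume x: "x \<in> carrier I" and y: "y \<in> carrier I" and z: "z \<in> carrier I"
  let ?ws = "[x, y, z]"
  from ptE[OF x, of ?ws] obtain f where f: "x = pt ?ws f" "pts ?ws f" by auto
  from ptE[OF y, of ?ws] obtain g where g: "y = pt ?ws g" "pts ?ws g" by auto
  from ptE[OF z, of ?ws] obtain h where h: "z = pt ?ws h" "pts ?ws h" by auto
  have "eventually (\<lambda>xs. f xs \<oplus>\<^bsub>alg xs\<^esub> g xs \<oplus>\<^bsub>alg xs\<^esub> h xs = f xs \<oplus>\<^bsub>alg xs\<^esub> (g xs \<oplus>\<^bsub>alg xs\<^esub> h xs)) (F ?ws)"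
    using f(2) g(2) h(2) eventually_cstar
    by eventually_elim (meson cstar_algebra.axioms(2) ring.ring_simprules(7))
  then show "x \<oplus>\<^bsub>I\<^esub> y \<oplus>\<^bsub>I\<^esub> z = x \<oplus>\<^bsub>I\<^esub> (y \<oplus>\<^bsub>I\<^esub> z)"
    using pt_add[OF f(2) g(2)] pt_add[OF g(2) h(2)] pt_add(1)[OF pt_add(2)[OF f(2) g(2)] h(2)]
      pt_add(1)[OF f(2) pt_add(2)[OF g(2) h(2)]] by (simp add: pt_eq_iff flip: f(1) g(1) h(1))
next
  fix x assume x: "x \<in> carrier I"
  let ?ws = "[x]"
  from ptE[OF x, of ?ws] obtain f where f: "x = pt ?ws f" "pts ?ws f" by auto
  have "eventually (\<lambda>xs. \<zero>\<^bsub>alg xs\<^esub> \<oplus>\<^bsub>alg xs\<^esub> f xs = f xs) (F ?ws)"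
    using f(2) eventually_cstar
    by eventually_elim (meson cstar_algebra.axioms(2) ring.ring_simprules(8))
  then show "\<zero>\<^bsub>I\<^esub> \<oplus>\<^bsub>I\<^esub> x = x"
    using pt_add(1)[OF pt_zero(2) f(2)] f(1) pt_zero(1)[of ?ws] by (metis pt_eq_iff)
  let ?g = "\<lambda>xs. \<ominus>\<^bsub>alg xs\<^esub> f xs"
  have g: "pts ?ws ?g" "eventually (\<lambda>xs. ?g xs \<oplus>\<^bsub>alg xs\<^esub> f xs = \<zero>\<^bsub>alg xs\<^esub>) (F ?ws)"
    using f(2) eventually_cstar
    by (eventually_elim, meson cstar_algebra.axioms(2) ring.ring_simprules(3) ring.ring_simprules(9))+
  then show "\<exists>y\<in>carrier I. y \<oplus>\<^bsub>I\<^esub> x = \<zero>\<^bsub>I\<^esub>"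
    using pt_add(1)[OF g(1) f(2)] f(1) pt_zero(1)[of ?ws]
    by (intro bexI[of _ "pt ?ws ?g"]) (auto simp: in_carrier_pt pt_eq_iff)
qed

lemma pt_minus:
  assumes f: "pts ws f" and g: "pts ws g"
  shows "pt ws f \<ominus>\<^bsub>I\<^esub> pt ws g = pt ws (\<lambda>xs. f xs \<ominus>\<^bsub>alg xs\<^esub> g xs)"
    and "pts ws (\<lambda>xs. f xs \<ominus>\<^bsub>alg xs\<^esub> g xs)"
proof -
  let ?h = "\<lambda>xs. \<ominus>\<^bsub>alg xs\<^esub> g xs"
  have h: "pts ws ?h" "eventually (\<lambda>xs. ?h xs \<oplus>\<^bsub>alg xs\<^esub> g xs = \<zero>\<^bsub>alg xs\<^esub>) (F ws)"
    using g eventually_cstar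
    by (eventually_elim, meson cstar_algebra.axioms(2) ring.ring_simprules(3) ring.ring_simprules(9))+
  then have "pt ws ?h \<oplus>\<^bsub>I\<^esub> pt ws g = \<zero>\<^bsub>I\<^esub>"
    using pt_add(1)[OF h(1) g] pt_zero(1)[of ws] by (simp add: pt_eq_iff)
  \<comment> \<open>The pointwise negative is an additive inverse, hence the inverse by
    uniqueness.\<close>
  then have "\<ominus>\<^bsub>I\<^esub> pt ws g = pt ws ?h"
    using g h(1) by (intro abelian_group.minus_equality[OF abelian_group_internal]) (auto simp: in_carrier_pt)
  then show "pt ws f \<ominus>\<^bsub>I\<^esub> pt ws g = pt ws (\<lambda>xs. f xs \<ominus>\<^bsub>alg xs\<^esub> g xs)"
    using pt_add(1)[OF f h(1)] by (simp add: a_minus_def)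
  show "pts ws (\<lambda>xs. f xs \<ominus>\<^bsub>alg xs\<^esub> g xs)"
    using pt_add(2)[OF f h(1)] by (simp add: a_minus_def)
qed

section \<open>Infinitesimal and finite norms\<close>

lemma hr_approx_rl:
  "hr_approx U (rl ws f) (star U (OReal 0)) \<longleftrightarrow> (\<forall>e>0. eventually (\<lambda>xs. \<bar>f xs\<bar> < e) (F ws))"
    (is "?l \<longleftrightarrow> ?r")
proof -
  have *: "[rl ws f, star U (OReal 0)] \<in> ext U {[OReal x, OReal y] | x y. \<bar>x - y\<bar> < 1 / real n} \<longleftrightarrow>
      eventually (\<lambda>xs. \<bar>f xs\<bar> < 1 / real n) (F ws)" for n
    using map_val_in_ext[of "M # ws" "[\<lambda>xs. OReal (f xs), \<lambda>_. OReal 0]"]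
    by (simp add: rl_def star_eq_val[of _ "M # ws"])
  show ?thesis
  proof
    assume ?l
    show ?r
    proof (intro allI impI)
      fix e :: real assume "e > 0"
      then obtain n where n: "inverse (real (Suc n)) < e"
        using reals_Archimedean by blast
      have "eventually (\<lambda>xs. \<bar>f xs\<bar> < 1 / real (Suc n)) (F ws)"
        using \<open>?l\<close> unfolding hr_approx_def * by auto
      then show "eventually (\<lambda>xs. \<bar>f xs\<bar> < e) (F ws)"
        by eventually_elim (use n in \<open>simp add: inverse_eq_divide\<close>)
    qed
  next
    assume ?r
    then show ?l unfolding hr_approx_def * by auto
  qed
qed

lemma hr_finite_rl:
  "hr_finite U (rl ws f) \<longleftrightarrow> (\<exists>K. eventually (\<lambda>xs. \<bar>f xs\<bar> \<le> K) (F ws))" (is "?l \<longleftrightarrow> ?r")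
proof -
  have *: "[rl ws f] \<in> ext U {[OReal x] | x. \<bar>x\<bar> < real n} \<longleftrightarrow>
      eventually (\<lambda>xs. \<bar>f xs\<bar> < real n) (F ws)" for n
    using map_val_in_ext[of "M # ws" "[\<lambda>xs. OReal (f xs)]"] by (simp add: rl_def)
  show ?thesis
  proof
    assume ?l
    then show ?r unfolding hr_finite_def * by (blast intro: eventually_mono less_imp_le)
  next
    assume ?r
    then obtain K where K: "eventually (\<lambda>xs. \<bar>f xs\<bar> \<le> K) (F ws)" by blast
    obtain n :: nat where "K < real n" using reals_Archimedean2 by blast
    with K have "eventually (\<lambda>xs. \<bar>f xs\<bar> < real n) (F ws)"
      by (auto elim: eventually_mono)
    then show ?l unfolding hr_finite_def * by blast
  qed
qed

text \<open>The working form of infinite closeness: an estimate valid in every C*-algebra can be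
  applied at almost every tuple and read off here for each standard \<open>e\<close>.\<close>

lemma approx_pt:
  assumes "pts ws f" "pts ws g"
  shows "approx U M (pt ws f) (pt ws g) \<longleftrightarrow>
    (\<forall>e>0. eventually (\<lambda>xs. nrm (alg xs) (f xs \<ominus>\<^bsub>alg xs\<^esub> g xs) < e) (F ws))"
proof -
  have nn: "eventually (\<lambda>xs. \<bar>nrm (alg xs) (f xs \<ominus>\<^bsub>alg xs\<^esub> g xs)\<bar> = nrm (alg xs) (f xs \<ominus>\<^bsub>alg xs\<^esub> g xs)) (F ws)"
    using pt_minus(2)[OF assms] eventually_cstar
    by eventually_elim (simp add: cstar_algebra.nrm_nonneg)
  have "eventually (\<lambda>xs. \<bar>nrm (alg xs) (f xs \<ominus>\<^bsub>alg xs\<^esub> g xs)\<bar> < e) (F ws) \<longleftrightarrow>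
        eventually (\<lambda>xs. nrm (alg xs) (f xs \<ominus>\<^bsub>alg xs\<^esub> g xs) < e) (F ws)" for e
    by (rule eventually_cong[OF nn]) simp
  then show ?thesis
    by (simp add: approx_def pt_minus[OF assms] pt_nrm hr_approx_rl)
qed

text \<open>The bound is taken nonnegative so that bounds can be multiplied.\<close>

lemma Fin_pt:
  "pt ws f \<in> Fin U M \<longleftrightarrow> pts ws f \<and> (\<exists>K\<ge>0. eventually (\<lambda>xs. nrm (alg xs) (f xs) \<le> K) (F ws))"
proof (cases "pts ws f")
  case True
  have nn: "eventually (\<lambda>xs. 0 \<le> nrm (alg xs) (f xs)) (F ws)"
    using True eventually_cstar by eventually_elim (rule cstar_algebra.nrm_nonneg)
  have "(\<exists>K. eventually (\<lambda>xs. \<bar>nrm (alg xs) (f xs)\<bar> \<le> K) (F ws)) \<longleftrightarrow>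
        (\<exists>K\<ge>0. eventually (\<lambda>xs. nrm (alg xs) (f xs) \<le> K) (F ws))" (is "?l \<longleftrightarrow> ?r")
  proof
    assume ?l
    then obtain K where K: "eventually (\<lambda>xs. \<bar>nrm (alg xs) (f xs)\<bar> \<le> K) (F ws)" by blast
    then have "eventually (\<lambda>xs. nrm (alg xs) (f xs) \<le> \<bar>K\<bar>) (F ws)"
      by eventually_elim auto
    then show ?r by (intro exI[of _ "\<bar>K\<bar>"]) auto
  next
    assume ?r
    then obtain K where "eventually (\<lambda>xs. nrm (alg xs) (f xs) \<le> K) (F ws)" by blast
    with nn have "eventually (\<lambda>xs. \<bar>nrm (alg xs) (f xs)\<bar> \<le> K) (F ws)"
      by eventually_elim auto
    then show ?l ..
  qed
  with True show ?thesis
    by (simp add: Fin_def in_carrier_pt pt_nrm hr_finite_rl)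
qed (simp add: Fin_def in_carrier_pt)

section \<open>Finite elements and infinite closeness\<close>

lemma mult_closed: "\<lbrakk>a \<in> carrier I; b \<in> carrier I\<rbrakk> \<Longrightarrow> a \<otimes>\<^bsub>I\<^esub> b \<in> carrier I"
  and adj_closed: "a \<in> carrier I \<Longrightarrow> adj I a \<in> carrier I"
proof -
  assume a: "a \<in> carrier I"
  from ptE[OF a, of "[a]"] obtain f where f: "a = pt [a] f" "pts [a] f" by auto
  show "adj I a \<in> carrier I"
    using pt_adj[OF f(2)] by (simp add: in_carrier_pt flip: f(1))
next
  assume a: "a \<in> carrier I" and b: "b \<in> carrier I"
  let ?ws = "[a, b]"
  from ptE[OF a, of ?ws] obtain f where f: "a = pt ?ws f" "pts ?ws f" by auto
  from ptE[OF b, of ?ws] obtain g where g: "b = pt ?ws g" "pts ?ws g" by auto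
  show "a \<otimes>\<^bsub>I\<^esub> b \<in> carrier I"
    using pt_mult[OF f(2) g(2)] by (simp add: in_carrier_pt flip: f(1) g(1))
qed

lemma approx_refl:
  assumes a: "a \<in> carrier I" shows "approx U M a a"
proof -
  from ptE[OF a, of "[a]"] obtain f where f: "a = pt [a] f" "pts [a] f" by auto
  have "eventually (\<lambda>xs. nrm (alg xs) (f xs \<ominus>\<^bsub>alg xs\<^esub> f xs) < e) (F [a])" if "e > 0" for e
    using f(2) eventually_cstar
    by eventually_elim (use that in \<open>simp add: cstar_algebra.minus_self cstar_algebra.nrm_zero\<close>)
  then show ?thesis
    using approx_pt[OF f(2) f(2)] by (simp flip: f(1))
qed

lemma approx_sym:
  assumes a: "a \<in> carrier I" and b: "b \<in> carrier I" and ab: "approx U M a b"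
  shows "approx U M b a"
proof -
  let ?ws = "[a, b]"
  from ptE[OF a, of ?ws] obtain f where f: "a = pt ?ws f" "pts ?ws f" by auto
  from ptE[OF b, of ?ws] obtain g where g: "b = pt ?ws g" "pts ?ws g" by auto
  have "eventually (\<lambda>xs. nrm (alg xs) (g xs \<ominus>\<^bsub>alg xs\<^esub> f xs) < e) (F ?ws)" if "e > 0" for e
  proof -
    have "eventually (\<lambda>xs. nrm (alg xs) (f xs \<ominus>\<^bsub>alg xs\<^esub> g xs) < e) (F ?ws)"
      using ab that approx_pt[OF f(2) g(2)] by (simp flip: f(1) g(1))
    then show ?thesis
      using f(2) g(2) eventually_cstar
      by eventually_elim (simp add: cstar_algebra.nrm_minus_commute)
  qed
  then show ?thesis
    using approx_pt[OF g(2) f(2)] by (simp flip: f(1) g(1))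
qed

lemma approx_trans:
  assumes a: "a \<in> carrier I" and b: "b \<in> carrier I" and c: "c \<in> carrier I"
    and ab: "approx U M a b" and bc: "approx U M b c"
  shows "approx U M a c"
proof -
  let ?ws = "[a, b, c]"
  from ptE[OF a, of ?ws] obtain f where f: "a = pt ?ws f" "pts ?ws f" by auto
  from ptE[OF b, of ?ws] obtain g where g: "b = pt ?ws g" "pts ?ws g" by auto
  from ptE[OF c, of ?ws] obtain h where h: "c = pt ?ws h" "pts ?ws h" by auto
  have "eventually (\<lambda>xs. nrm (alg xs) (f xs \<ominus>\<^bsub>alg xs\<^esub> h xs) < e) (F ?ws)" if "e > 0" for e
  proof -
    have "\<forall>e>0. eventually (\<lambda>xs. nrm (alg xs) (f xs \<ominus>\<^bsub>alg xs\<^esub> g xs) < e) (F ?ws)"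
      "\<forall>e>0. eventually (\<lambda>xs. nrm (alg xs) (g xs \<ominus>\<^bsub>alg xs\<^esub> h xs) < e) (F ?ws)"
      using ab bc approx_pt[OF f(2) g(2)] approx_pt[OF g(2) h(2)] by (simp_all flip: f(1) g(1) h(1))
    then have "eventually (\<lambda>xs. nrm (alg xs) (f xs \<ominus>\<^bsub>alg xs\<^esub> g xs) < e / 2) (F ?ws)"
      "eventually (\<lambda>xs. nrm (alg xs) (g xs \<ominus>\<^bsub>alg xs\<^esub> h xs) < e / 2) (F ?ws)"
      using half_gt_zero[OF that] by blast+
    then show ?thesis
      using f(2) g(2) h(2) eventually_cstar
    proof eventually_elim
      case (elim xs)
      then show ?case
        using cstar_algebra.nrm_minus_triangle[OF elim(6,3-5)] by linarith
    qed
  qed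
  then show ?thesis
    using approx_pt[OF f(2) h(2)] by (simp flip: f(1) h(1))
qed

lemma hat_eq_iff:
  assumes "a \<in> carrier I" "b \<in> carrier I"
  shows "hat U M a = hat U M b \<longleftrightarrow> approx U M a b"
  unfolding hat_def using assms approx_refl approx_sym approx_trans by blast

lemma Fin_carrier: "a \<in> Fin U M \<Longrightarrow> a \<in> carrier I"
  by (simp add: Fin_def)

lemma Fin_adj:
  assumes "a \<in> Fin U M" shows "adj I a \<in> Fin U M"
proof -
  from ptE[OF Fin_carrier[OF assms], of "[a]"] obtain f where f: "a = pt [a] f" "pts [a] f" by auto
  from assms obtain K where K: "K \<ge> 0" "eventually (\<lambda>xs. nrm (alg xs) (f xs) \<le> K) (F [a])"
    by (subst (asm) f(1)) (auto simp: Fin_pt)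
  have "eventually (\<lambda>xs. nrm (alg xs) (adj (alg xs) (f xs)) \<le> K) (F [a])"
    using K(2) f(2) eventually_cstar by eventually_elim (simp add: cstar_algebra.nrm_adj)
  then have "pt [a] (\<lambda>xs. adj (alg xs) (f xs)) \<in> Fin U M"
    using pt_adj(2)[OF f(2)] K(1) by (auto simp: Fin_pt)
  then show ?thesis
    using pt_adj(1)[OF f(2)] by (simp flip: f(1))
qed

lemma Fin_mult:
  assumes a: "a \<in> Fin U M" and b: "b \<in> Fin U M" shows "a \<otimes>\<^bsub>I\<^esub> b \<in> Fin U M"
proof -
  let ?ws = "[a, b]"
  from ptE[OF Fin_carrier[OF a], of ?ws] obtain f where f: "a = pt ?ws f" "pts ?ws f" by auto
  from ptE[OF Fin_carrier[OF b], of ?ws] obtain g where g: "b = pt ?ws g" "pts ?ws g" by auto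
  from a obtain K where K: "K \<ge> 0" "eventually (\<lambda>xs. nrm (alg xs) (f xs) \<le> K) (F ?ws)"
    by (subst (asm) f(1)) (auto simp: Fin_pt)
  from b obtain L where L: "L \<ge> 0" "eventually (\<lambda>xs. nrm (alg xs) (g xs) \<le> L) (F ?ws)"
    by (subst (asm) g(1)) (auto simp: Fin_pt)
  from K(2) L(2) f(2) g(2) eventually_cstar
  have "eventually (\<lambda>xs. nrm (alg xs) (f xs \<otimes>\<^bsub>alg xs\<^esub> g xs) \<le> K * L) (F ?ws)"
  proof eventually_elim
    case (elim xs)
    have "nrm (alg xs) (f xs) * nrm (alg xs) (g xs) \<le> K * L"
      using elim(1,2) K(1) cstar_algebra.nrm_nonneg[OF elim(5,4)] by (rule mult_mono)
    then show ?case
      using cstar_algebra.nrm_mult[OF elim(5,3,4)] by linarith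
  qed
  then have "pt ?ws (\<lambda>xs. f xs \<otimes>\<^bsub>alg xs\<^esub> g xs) \<in> Fin U M"
    using pt_mult(2)[OF f(2) g(2)] mult_nonneg_nonneg[OF K(1) L(1)] by (auto simp: Fin_pt)
  then show ?thesis
    using pt_mult(1)[OF f(2) g(2)] by (simp flip: f(1) g(1))
qed

lemma approx_adj:
  assumes a: "a \<in> carrier I" and b: "b \<in> carrier I" and ab: "approx U M a b"
  shows "approx U M (adj I a) (adj I b)"
proof -
  let ?ws = "[a, b]"
  from ptE[OF a, of ?ws] obtain f where f: "a = pt ?ws f" "pts ?ws f" by auto
  from ptE[OF b, of ?ws] obtain g where g: "b = pt ?ws g" "pts ?ws g" by auto
  have "eventually (\<lambda>xs. nrm (alg xs) (adj (alg xs) (f xs) \<ominus>\<^bsub>alg xs\<^esub> adj (alg xs) (g xs)) < e) (F ?ws)"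
    if "e > 0" for e
  proof -
    have "eventually (\<lambda>xs. nrm (alg xs) (f xs \<ominus>\<^bsub>alg xs\<^esub> g xs) < e) (F ?ws)"
      using ab that approx_pt[OF f(2) g(2)] by (simp flip: f(1) g(1))
    then show ?thesis
      using f(2) g(2) pt_minus(2)[OF f(2) g(2)] eventually_cstar
      by eventually_elim (simp add: cstar_algebra.nrm_adj flip: cstar_algebra.adj_minus)
  qed
  then show ?thesis
    using approx_pt[OF pt_adj(2)[OF f(2)] pt_adj(2)[OF g(2)]] pt_adj(1)[OF f(2)] pt_adj(1)[OF g(2)]
    by (simp flip: f(1) g(1))
qed

text \<open>The finiteness assumptions concern \<open>b\<close> and \<open>a'\<close>, the two
  factors whose norms appear in the telescoped product estimate.\<close>

lemma approx_mult:
  assumes a: "a \<in> carrier I" and b: "b \<in> Fin U M" and a': "a' \<in> Fin U M" and b': "b' \<in> carrier I"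
    and aa: "approx U M a a'" and bb: "approx U M b b'"
  shows "approx U M (a \<otimes>\<^bsub>I\<^esub> b) (a' \<otimes>\<^bsub>I\<^esub> b')"
proof -
  let ?ws = "[a, b, a', b']"
  from ptE[OF a, of ?ws] obtain f where f: "a = pt ?ws f" "pts ?ws f" by auto
  from ptE[OF Fin_carrier[OF b], of ?ws] obtain g where g: "b = pt ?ws g" "pts ?ws g" by auto
  from ptE[OF Fin_carrier[OF a'], of ?ws] obtain f' where f': "a' = pt ?ws f'" "pts ?ws f'" by auto
  from ptE[OF b', of ?ws] obtain g' where g': "b' = pt ?ws g'" "pts ?ws g'" by auto
  from b obtain K where K: "K \<ge> 0" "eventually (\<lambda>xs. nrm (alg xs) (g xs) \<le> K) (F ?ws)"
    by (subst (asm) g(1)) (auto simp: Fin_pt)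
  from a' obtain L where L: "L \<ge> 0" "eventually (\<lambda>xs. nrm (alg xs) (f' xs) \<le> L) (F ?ws)"
    by (subst (asm) f'(1)) (auto simp: Fin_pt)
  have "eventually (\<lambda>xs. nrm (alg xs) (f xs \<otimes>\<^bsub>alg xs\<^esub> g xs \<ominus>\<^bsub>alg xs\<^esub> f' xs \<otimes>\<^bsub>alg xs\<^esub> g' xs) < e) (F ?ws)"
    if "e > 0" for e
  proof -
    \<comment> \<open>The summand 1 keeps the denominator positive and makes the resulting
      inequality strict.\<close>
    define d where "d = e / (K + L + 1)"
    have d: "d > 0" using that K L by (simp add: d_def)
    have "d * K + L * d < d * (K + L + 1)"
      using d by (simp add: algebra_simps)
    also have "\<dots> = e"
      using K L by (simp add: d_def)
    finally have e: "d * K + L * d < e" .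
    have "eventually (\<lambda>xs. nrm (alg xs) (f xs \<ominus>\<^bsub>alg xs\<^esub> f' xs) < d) (F ?ws)"
      "eventually (\<lambda>xs. nrm (alg xs) (g xs \<ominus>\<^bsub>alg xs\<^esub> g' xs) < d) (F ?ws)"
      using aa bb d approx_pt[OF f(2) f'(2)] approx_pt[OF g(2) g'(2)]
      by (simp_all flip: f(1) g(1) f'(1) g'(1))
    then show ?thesis
      using K(2) L(2) f(2) g(2) f'(2) g'(2) eventually_cstar
    proof eventually_elim
      case (elim xs)
      interpret A: cstar_algebra "alg xs" by (rule elim(9))
      have "nrm (alg xs) (f xs \<ominus>\<^bsub>alg xs\<^esub> f' xs) * nrm (alg xs) (g xs) \<le> d * K"
        using elim d K by (intro mult_mono) (auto intro: A.nrm_nonneg)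
      moreover have "nrm (alg xs) (f' xs) * nrm (alg xs) (g xs \<ominus>\<^bsub>alg xs\<^esub> g' xs) \<le> L * d"
        using elim d L by (intro mult_mono) (auto intro: A.nrm_nonneg)
      ultimately show ?case
        using A.nrm_mult_minus_le[OF elim(5-8)] e by linarith
    qed
  qed
  then show ?thesis
    using approx_pt[OF pt_mult(2)[OF f(2) g(2)] pt_mult(2)[OF f'(2) g'(2)]]
      pt_mult(1)[OF f(2) g(2)] pt_mult(1)[OF f'(2) g'(2)]
    by (simp flip: f(1) g(1) f'(1) g'(1))
qed

text \<open>Hull operations run over all representatives of a class, so every representative of a
  finite class has to be finite.\<close>

lemma Fin_approx:
  assumes a: "a \<in> Fin U M" and b: "b \<in> carrier I" and ba: "approx U M b a"
  shows "b \<in> Fin U M"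
proof -
  let ?ws = "[a, b]"
  from ptE[OF Fin_carrier[OF a], of ?ws] obtain f where f: "a = pt ?ws f" "pts ?ws f" by auto
  from ptE[OF b, of ?ws] obtain g where g: "b = pt ?ws g" "pts ?ws g" by auto
  from a obtain K where K: "K \<ge> 0" "eventually (\<lambda>xs. nrm (alg xs) (f xs) \<le> K) (F ?ws)"
    by (subst (asm) f(1)) (auto simp: Fin_pt)
  have "eventually (\<lambda>xs. nrm (alg xs) (g xs \<ominus>\<^bsub>alg xs\<^esub> f xs) < 1) (F ?ws)"
    using ba approx_pt[OF g(2) f(2)] by (simp flip: f(1) g(1))
  with K(2) have "eventually (\<lambda>xs. nrm (alg xs) (g xs) \<le> K + 1) (F ?ws)"
    using f(2) g(2) eventually_cstar
  proof eventually_elim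
    case (elim xs)
    then show ?case
      using cstar_algebra.nrm_le_minus[OF elim(5,4,3)] by linarith
  qed
  then have "pt ?ws g \<in> Fin U M"
    using g(2) K(1) by (auto simp: Fin_pt intro!: exI[of _ "K + 1"])
  then show ?thesis by (simp flip: g(1))
qed

section \<open>Hull operations on representatives\<close>

lemma hat_self: "a \<in> carrier I \<Longrightarrow> a \<in> hat U M a"
  by (simp add: hat_def approx_refl)

lemma hull_carrier: "carrier H = hat U M ` Fin U M"
  by (simp add: nonstandard_hull_def Let_def)

text \<open>Products of infinitely close finite elements are infinitely close, so the union defining
  the hull product ranges over copies of a single class.\<close>

lemma hull_mult:
  assumes a: "a \<in> Fin U M" and b: "b \<in> Fin U M"
  shows "hat U M a \<otimes>\<^bsub>H\<^esub> hat U M b = hat U M (a \<otimes>\<^bsub>I\<^esub> b)"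
proof -
  have "hat U M (a' \<otimes>\<^bsub>I\<^esub> b') = hat U M (a \<otimes>\<^bsub>I\<^esub> b)"
    if "a' \<in> hat U M a" "b' \<in> hat U M b" for a' b'
  proof -
    from that have c: "a' \<in> carrier I" "b' \<in> carrier I" "approx U M a' a" "approx U M b' b"
      by (auto simp: hat_def)
    have "b' \<in> Fin U M"
      using Fin_approx[OF b c(2,4)] .
    then show ?thesis
      using approx_mult[OF c(1) _ a Fin_carrier[OF b] c(3,4)] c a b
      by (subst hat_eq_iff) (auto intro: mult_closed Fin_carrier)
  qed
  then have "(\<Union>a'\<in>hat U M a. \<Union>b'\<in>hat U M b. hat U M (a' \<otimes>\<^bsub>I\<^esub> b')) = hat U M (a \<otimes>\<^bsub>I\<^esub> b)"
    using hat_self[OF Fin_carrier[OF a]] hat_self[OF Fin_carrier[OF b]] by blast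
  then show ?thesis
    by (simp add: nonstandard_hull_def Let_def)
qed

lemma hull_adj:
  assumes a: "a \<in> Fin U M"
  shows "adj H (hat U M a) = hat U M (adj I a)"
proof -
  have "hat U M (adj I a') = hat U M (adj I a)" if "a' \<in> hat U M a" for a'
    using that a approx_adj[of a' a]
    by (subst hat_eq_iff) (auto simp: hat_def intro: adj_closed Fin_carrier)
  then have "(\<Union>a'\<in>hat U M a. hat U M (adj I a')) = hat U M (adj I a)"
    using hat_self[OF Fin_carrier[OF a]] by blast
  then show ?thesis
    by (simp add: nonstandard_hull_def Let_def)
qed

section \<open>Infinite projections of the algebra and of its hull\<close>

lemma Fin_bounded_pt:
  assumes "pts ws f" "eventually (\<lambda>xs. nrm (alg xs) (f xs) \<le> 1) (F ws)"
  shows "pt ws f \<in> Fin U M"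
  using assms zero_le_one unfolding Fin_pt by blast

text \<open>Projections have norm at most 1, so \<open>p\<close> is finite; the defining equations
  hold exactly in \<open>I\<close> and descend to classes.\<close>

lemma hull_projection:
  assumes "internally U is_projection M p"
  shows "is_projection H (hat U M p)" "p \<in> Fin U M"
proof -
  let ?ws = "[p]"
  from ptE[OF internally_carrier[OF assms], of ?ws]
  obtain f where f: "p = pt ?ws f" "pts ?ws f" by auto
  have pr: "eventually (\<lambda>xs. is_projection (alg xs) (f xs)) (F ?ws)"
    using assms by (subst (asm) f(1)) (auto simp: internally_pt elim: eventually_mono)
  have "eventually (\<lambda>xs. nrm (alg xs) (f xs) \<le> 1) (F ?ws)"
    using pr eventually_cstar by eventually_elim (rule cstar_algebra.projection_nrm(2))
  then show fin: "p \<in> Fin U M"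
    using Fin_bounded_pt[OF f(2)] by (simp flip: f(1))
  have "eventually (\<lambda>xs. f xs \<otimes>\<^bsub>alg xs\<^esub> f xs = f xs) (F ?ws)"
    "eventually (\<lambda>xs. adj (alg xs) (f xs) = f xs) (F ?ws)"
    using pr by (eventually_elim, simp add: is_projection_def)+
  then have "p \<otimes>\<^bsub>I\<^esub> p = p" "adj I p = p"
    using pt_mult(1)[OF f(2) f(2)] pt_adj(1)[OF f(2)] unfolding pt_eq_iff[symmetric]
    by (simp_all flip: f(1))
  then show "is_projection H (hat U M p)"
    using fin by (simp add: is_projection_def hull_carrier hull_mult hull_adj)
qed

lemma hull_infinite_projection:
  assumes "internally U infinite_projection M p"
  shows "infinite_projection H (hat U M p)"
proof -
  let ?ws = "[p]"
  from ptE[OF internally_carrier[OF assms], of ?ws]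
  obtain f where f: "p = pt ?ws f" "pts ?ws f" by auto
  have inf: "eventually (\<lambda>xs. infinite_projection (alg xs) (f xs)) (F ?ws)"
    using assms by (subst (asm) f(1)) (auto simp: internally_pt elim: eventually_mono)
  \<comment> \<open>A partial isometry is chosen at each standard tuple; the value of
    \<open>g\<close> is the internal witness.\<close>
  define g where "g xs = (SOME u. u \<in> carrier (alg xs) \<and> adj (alg xs) u \<otimes>\<^bsub>alg xs\<^esub> u = f xs \<and>
    is_projection (alg xs) (u \<otimes>\<^bsub>alg xs\<^esub> adj (alg xs) u) \<and>
    proj_le (alg xs) (u \<otimes>\<^bsub>alg xs\<^esub> adj (alg xs) u) (f xs) \<and> u \<otimes>\<^bsub>alg xs\<^esub> adj (alg xs) u \<noteq> f xs)" for xs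
  define q where "q = (\<lambda>xs. g xs \<otimes>\<^bsub>alg xs\<^esub> adj (alg xs) (g xs))"
  have ev: "eventually (\<lambda>xs. is_projection (alg xs) (f xs) \<and> g xs \<in> carrier (alg xs) \<and>
      adj (alg xs) (g xs) \<otimes>\<^bsub>alg xs\<^esub> g xs = f xs \<and> is_projection (alg xs) (q xs) \<and>
      proj_le (alg xs) (q xs) (f xs) \<and> q xs \<noteq> f xs) (F ?ws)"
    using inf
  proof eventually_elim
    case (elim xs)
    then have "\<exists>u. u \<in> carrier (alg xs) \<and> adj (alg xs) u \<otimes>\<^bsub>alg xs\<^esub> u = f xs \<and>
      is_projection (alg xs) (u \<otimes>\<^bsub>alg xs\<^esub> adj (alg xs) u) \<and>
      proj_le (alg xs) (u \<otimes>\<^bsub>alg xs\<^esub> adj (alg xs) u) (f xs) \<and> u \<otimes>\<^bsub>alg xs\<^esub> adj (alg xs) u \<noteq> f xs"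
      by (auto simp: infinite_projection_def mvn_equiv_def partial_isometry_def)
    from someI_ex[OF this] elim show ?case
      unfolding g_def[symmetric] q_def by (simp add: infinite_projection_def)
  qed
  then have pg: "pts ?ws g" by eventually_elim simp
  have "eventually (\<lambda>xs. nrm (alg xs) (g xs) \<le> 1) (F ?ws)"
    using ev eventually_cstar by eventually_elim (rule cstar_algebra.partial_isometry_nrm, auto)
  then have gfin: "pt ?ws g \<in> Fin U M"
    using Fin_bounded_pt pg by blast
  note pag = pt_adj[OF pg]
  have "pt ?ws g \<otimes>\<^bsub>I\<^esub> adj I (pt ?ws g) = pt ?ws q"
    using pt_mult(1)[OF pg pag(2)] pag(1) by (simp add: q_def)
  moreover have pq: "pts ?ws q"
    using pt_mult(2)[OF pg pag(2)] by (simp add: q_def)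
  moreover have "eventually (\<lambda>xs. adj (alg xs) (g xs) \<otimes>\<^bsub>alg xs\<^esub> g xs = f xs) (F ?ws)"
    "eventually (\<lambda>xs. f xs \<otimes>\<^bsub>alg xs\<^esub> q xs = q xs) (F ?ws)"
    "eventually (\<lambda>xs. q xs \<otimes>\<^bsub>alg xs\<^esub> f xs = q xs) (F ?ws)"
    using ev by (eventually_elim, simp add: proj_le_def)+
  ultimately have eqs: "pt ?ws g \<otimes>\<^bsub>I\<^esub> adj I (pt ?ws g) = pt ?ws q"
    "adj I (pt ?ws g) \<otimes>\<^bsub>I\<^esub> pt ?ws g = p" "p \<otimes>\<^bsub>I\<^esub> pt ?ws q = pt ?ws q" "pt ?ws q \<otimes>\<^bsub>I\<^esub> p = pt ?ws q"
    using pt_mult(1)[OF pag(2) pg] pag(1) pt_mult(1)[OF f(2) pq] pt_mult(1)[OF pq f(2)]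
    unfolding pt_eq_iff[symmetric] by (simp_all flip: f(1))
  have "internally U is_projection M (pt ?ws f)" "internally U is_projection M (pt ?ws q)"
    using ev unfolding internally_pt by (auto elim!: eventually_mono simp: is_projection_def)
  then have p: "is_projection H (hat U M p)" "p \<in> Fin U M"
    and q: "is_projection H (hat U M (pt ?ws q))" "pt ?ws q \<in> Fin U M"
    using hull_projection by (simp_all flip: f(1))
  \<comment> \<open>Equal classes would make the distance of \<open>q xs\<close> and
    \<open>f xs\<close> eventually less than 1, while distinct comparable projections are at
    distance exactly 1.\<close>
  have ne: "hat U M (pt ?ws q) \<noteq> hat U M p"
  proof
    assume "hat U M (pt ?ws q) = hat U M p"
    then have "approx U M (pt ?ws q) (pt ?ws f)"
      using p q by (simp add: hat_eq_iff Fin_carrier flip: f(1))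
    then have "eventually (\<lambda>xs. nrm (alg xs) (q xs \<ominus>\<^bsub>alg xs\<^esub> f xs) < 1) (F ?ws)"
      unfolding approx_pt[OF pq f(2)] by simp
    then have "eventually (\<lambda>xs. False) (F ?ws)"
      using ev eventually_cstar
      by eventually_elim (use cstar_algebra.nrm_projection_diff in fastforce)
    then show False by simp
  qed
  have "mvn_equiv H (hat U M p) (hat U M (pt ?ws q))"
    unfolding mvn_equiv_def partial_isometry_def
    using gfin p q eqs by (intro exI[of _ "hat U M (pt ?ws g)"])
      (auto simp: hull_carrier hull_adj hull_mult Fin_adj)
  moreover have "proj_le H (hat U M (pt ?ws q)) (hat U M p)"
    using p q eqs by (simp add: proj_le_def hull_mult)
  ultimately show ?thesis
    unfolding infinite_projection_def using p q ne by blast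
qed

lemma internally_infinite_projection:
  assumes p: "internally U is_projection M p" and inf: "infinite_projection H (hat U M p)"
  shows "internally U infinite_projection M p"
proof -
  from inf obtain V where V: "V \<in> carrier H" "adj H V \<otimes>\<^bsub>H\<^esub> V = hat U M p"
    and le: "hat U M p \<otimes>\<^bsub>H\<^esub> (V \<otimes>\<^bsub>H\<^esub> adj H V) = V \<otimes>\<^bsub>H\<^esub> adj H V" and ne: "V \<otimes>\<^bsub>H\<^esub> adj H V \<noteq> hat U M p"
    unfolding infinite_projection_def mvn_equiv_def partial_isometry_def proj_le_def by blast
  then obtain v where v: "v \<in> Fin U M" "V = hat U M v"
    by (auto simp: hull_carrier)
  note pf = hull_projection(2)[OF p]
  let ?ws = "[p, v]"
  from ptE[OF Fin_carrier[OF pf], of ?ws] obtain f where f: "p = pt ?ws f" "pts ?ws f" by auto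
  from ptE[OF Fin_carrier[OF v(1)], of ?ws] obtain g where g: "v = pt ?ws g" "pts ?ws g" by auto
  note ag = pt_adj[OF g(2), folded g(1)]
  note gg = pt_mult[OF ag(2) g(2), folded g(1) ag(1)] and gg' = pt_mult[OF g(2) ag(2), folded g(1) ag(1)]
  note fgg = pt_mult[OF f(2) gg'(2), folded f(1) gg'(1)]
  note fin = Fin_adj[OF v(1)] Fin_mult[OF v(1) Fin_adj[OF v(1)]] Fin_mult[OF Fin_adj[OF v(1)] v(1)]
  have c: "p \<in> carrier I" "adj I v \<otimes>\<^bsub>I\<^esub> v \<in> carrier I" "v \<otimes>\<^bsub>I\<^esub> adj I v \<in> carrier I"
    "p \<otimes>\<^bsub>I\<^esub> (v \<otimes>\<^bsub>I\<^esub> adj I v) \<in> carrier I"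
    using fin pf Fin_mult by (auto intro: Fin_carrier)
  have "approx U M (adj I v \<otimes>\<^bsub>I\<^esub> v) p" "approx U M (p \<otimes>\<^bsub>I\<^esub> (v \<otimes>\<^bsub>I\<^esub> adj I v)) (v \<otimes>\<^bsub>I\<^esub> adj I v)"
    "\<not> approx U M (v \<otimes>\<^bsub>I\<^esub> adj I v) p"
    using V le ne fin pf v by (simp_all add: hull_adj hull_mult hat_eq_iff c)
  then have close: "eventually (\<lambda>xs. nrm (alg xs) (adj (alg xs) (g xs) \<otimes>\<^bsub>alg xs\<^esub> g xs \<ominus>\<^bsub>alg xs\<^esub> f xs) < e) (F ?ws)"
      "eventually (\<lambda>xs. nrm (alg xs) (f xs \<otimes>\<^bsub>alg xs\<^esub> (g xs \<otimes>\<^bsub>alg xs\<^esub> adj (alg xs) (g xs)) \<ominus>\<^bsub>alg xs\<^esub>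
        g xs \<otimes>\<^bsub>alg xs\<^esub> adj (alg xs) (g xs)) < e) (F ?ws)"
    and far: "\<exists>e>0. \<not> eventually (\<lambda>xs. nrm (alg xs) (g xs \<otimes>\<^bsub>alg xs\<^esub> adj (alg xs) (g xs) \<ominus>\<^bsub>alg xs\<^esub> f xs) < e) (F ?ws)"
    if "e > 0" for e
    using that approx_pt[OF gg(2) f(2), folded gg(1) f(1)]
      approx_pt[OF fgg(2) gg'(2), folded gg'(1) fgg(1)] approx_pt[OF gg'(2) f(2), folded gg'(1) f(1)]
    by auto
  \<comment> \<open>The number 1 only discharges the positivity premise shared with
    \<open>close\<close>. Failure of infinite closeness gives a standard \<open>e\<close>, and the
    ultrafilter property makes the distance at least \<open>e\<close> at almost every tuple.\<close>
  from far[of 1] obtain e where e: "e > 0"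
    "eventually (\<lambda>xs. \<not> nrm (alg xs) (g xs \<otimes>\<^bsub>alg xs\<^esub> adj (alg xs) (g xs) \<ominus>\<^bsub>alg xs\<^esub> f xs) < e) (F ?ws)"
    by (auto simp: eventually_not_frame)
  \<comment> \<open>The minimum meets both bounds of the perturbation lemma, with the distance
    \<open>e\<close> in the role of \<eta>.\<close>
  define s where "s = min (e / 200) (1 / 200)"
  have s: "0 < s" "200 * s \<le> e" "200 * s \<le> 1"
    using e by (auto simp: s_def)
  have pr: "eventually (\<lambda>xs. is_projection (alg xs) (f xs)) (F ?ws)"
    using p by (subst (asm) f(1)) (auto simp: internally_pt elim: eventually_mono)
  \<comment> \<open>Infinitesimal errors are smaller than any standard positive number, in
    particular than \<open>s\<^sup>2\<close>.\<close>
  have "s\<^sup>2 > 0" using s by simp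
  note close[OF this]
  then have "eventually (\<lambda>xs. infinite_projection (alg xs) (f xs)) (F ?ws)"
    using e(2) pr g(2) eventually_cstar
  proof eventually_elim
    case (elim xs)
    then show ?case
      by (intro cstar_algebra.infinite_projection_perturb[OF elim(6,4,5) s]) auto
  qed
  with f(2) have "internally U infinite_projection M (pt ?ws f)"
    unfolding internally_pt by eventually_elim simp
  then show ?thesis by (simp flip: f(1))
qed

end

theorem theorem26:
  fixes \<kappa> :: "'k rel"
    and U :: "('x obj, 'w) universe"
    and M p :: 'w
  assumes "nonstandard_universe \<kappa> U"
    and "internal_cstar_algebra U M"
    and "internally U is_projection M p"
  shows "internally U infinite_projection M p \<longleftrightarrow>
         infinite_projection (nonstandard_hull U M) (hat U M p)"
proof -
  interpret internal_cstar U M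
    using assms(1,2) by unfold_locales (simp_all add: nonstandard_universe_def)
  show ?thesis
    using hull_infinite_projection internally_infinite_projection[OF assms(3)] by blast
qed

end
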